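(* Let $\mathcal{G}$ be an additive arithmetical semigroup satisfying Axiom $A^{\#}$ with constants $c_{\mathcal{G}}>0$, $q>1$, $0\le\eta<1$, and with $Z_{\mathcal{G}}(-q^{-1})\neq0$; equip it with the norm $\|g\|=q^{\partial(g)}$. Let $S\subseteq\mathcal{P}$ have natural density $\delta(S)$. Let $a\colon\mathcal{G}\to\mathbb{C}$ be supported on $\mathfrak{D}(\mathcal{G},S)$ with $a(e_{\mathcal{G}})=1$ and $$\lim_{n\to\infty}\sum_{\substack{1\le\partial(g)\le n\\ g\in\mathfrak{D}(\mathcal{G},S)}}\frac{|a(g)|}{\|g\|}\log\log\|g\|<\infty.$$ Then $$-\lim_{n\to\infty}\sum_{\substack{1\le\partial(g)\le n\\ g\in\mathfrak{D}(\mathcal{G},S)}}\frac{(\mu*a)(g)}{\|g\|}=\delta(S).$$ In particular, if $a$ is the identity of the convolution ring ($a(e_{\mathcal{G}})=1$, $a(g)=0$ otherwise), then $$-\lim_{n\to\infty}\sum_{\substack{1\le\partial(g)\le n\\ g\in\mathfrak{D}(\mathcal{G},S)}}\frac{\mu(g)}{\|g\|}=\delta(S).$$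
   Context: An additive arithmetical semigroup is a commutative monoid $\mathcal{G}$ (written additively, identity $e_{\mathcal{G}}$) freely generated by a countable set $\mathcal{P}$ of primes, with a degree map $\partial\colon\mathcal{G}\to\mathbb{Z}_{\ge0}$ satisfying $\partial(e_{\mathcal{G}})=0$, $\partial(P)>0$ for $P\in\mathcal{P}$, $\partial(g+h)=\partial(g)+\partial(h)$, and such that only finitely many elements have degree $\le x$ for each $x$. Let $G^{\#}(n)=\#\{g:\partial(g)=n\}$. Axiom $A^{\#}$: $G^{\#}(n)=c_{\mathcal{G}}q^n+O(q^{\eta n})$ with $c_{\mathcal{G}}>0$, $q>1$, $0\le\eta<1$. The zeta function is $Z_{\mathcal{G}}(z)=\prod_{P\in\mathcal{P}}(1-z^{\partial(P)})^{-1}$ (meromorphically continued), and it is assumed that $Z_{\mathcal{G}}(-q^{-1})\ne0$. Natural density: $\delta(S)=\lim_{n\to\infty}\#\{P\in S:\partial(P)=n\}/\#\{P\in\mathcal{P}:\partial(P)=n\}$. $h\mid g$ means $g=h+r$ for some $r\in\mathcal{G}$. For $g\ne e_{\mathcal{G}}$, $d_-(g)=\min\{\partial(P):P\in\mathcal{P},P\mid g\}$; $g$ is distinguishable if $g\ne e_{\mathcal{G}}$ and there is a unique prime $P_{\min}(g)\mid g$ with $\partial(P_{\min}(g))=d_-(g)$. $\mathfrak{D}(\mathcal{G},S)=\{g\text{ distinguishable}:P_{\min}(g)\in S\}\cup\{e_{\mathcal{G}}\}$. Möbius function: $\mu(e_{\mathcal{G}})=1$, $\mu(P_1+\dots+P_k)=(-1)^k$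 for distinct primes, $\mu(g)=0$ if $2P\mid g$ for some prime $P$. $a$ is supported on $\mathfrak{D}(\mathcal{G},S)$ if $a(g)=0$ for $g\notin\mathfrak{D}(\mathcal{G},S)$. $(\mu*a)(g)=\sum_{h\mid g}\mu(h)a(g-h)$, where $g-h$ denotes the $r$ with $h+r=g$. *)

theory Defs
  imports "HOL-Analysis.Analysis" "HOL-Library.Multiset"
begin

text \<open>The additive arithmetical semigroup freely generated by the primes (elements of type 'p)
  is modelled as the multisets over 'p; the identity is the empty multiset, the monoid
  operation is multiset sum, and the degree is determined by the degrees of the primes.\<close>

definition deg :: "('p \<Rightarrow> nat) \<Rightarrow> 'p multiset \<Rightarrow> nat" where
  "deg d g = (\<Sum>P\<in>#g. d P)"

definition Gsharp :: "('p \<Rightarrow> nat) \<Rightarrow> nat \<Rightarrow> nat" where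
  "Gsharp d n = card {g :: 'p multiset. deg d g = n}"

definition arith_semigroup :: "('p \<Rightarrow> nat) \<Rightarrow> bool" where
  "arith_semigroup d \<longleftrightarrow> (\<forall>P. d P > 0) \<and> (\<forall>x. finite {g :: 'p multiset. deg d g \<le> x})"

definition axiom_A_sharp :: "('p \<Rightarrow> nat) \<Rightarrow> real \<Rightarrow> real \<Rightarrow> real \<Rightarrow> bool" where
  "axiom_A_sharp d c q \<eta> \<longleftrightarrow> c > 0 \<and> q > 1 \<and> 0 \<le> \<eta> \<and> \<eta> < 1 \<and>
     (\<exists>C. \<forall>n. \<bar>real (Gsharp d n) - c * q ^ n\<bar> \<le> C * q powr (\<eta> * real n))"

text \<open>Z(-1/q) \<noteq> 0: the zeta function Z(z) = \<Sum> G#(n) z^n (= Euler product) on |z| < 1/q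
  continues meromorphically (holomorphically except at 1/q) to the disc |z| < q^(-\<eta>),
  which contains -1/q; the continuation is unique since the punctured disc is connected.\<close>
definition zeta_nonzero_at_minus :: "('p \<Rightarrow> nat) \<Rightarrow> real \<Rightarrow> real \<Rightarrow> bool" where
  "zeta_nonzero_at_minus d q \<eta> \<longleftrightarrow>
     (\<exists>F. F holomorphic_on (ball 0 (q powr (-\<eta>)) - {complex_of_real (1/q)}) \<and>
          (\<forall>z. norm z < 1/q \<longrightarrow> (\<lambda>n. of_nat (Gsharp d n) * z ^ n) sums F z) \<and>
          F (complex_of_real (-1/q)) \<noteq> 0)"

definition nat_density :: "('p \<Rightarrow> nat) \<Rightarrow> 'p set \<Rightarrow> real \<Rightarrow> bool" where
  "nat_density d S \<delta> \<longleftrightarrow>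
     ((\<lambda>n. real (card {P \<in> S. d P = n}) / real (card {P. d P = n})) \<longlonglongrightarrow> \<delta>)"

definition d_minus :: "('p \<Rightarrow> nat) \<Rightarrow> 'p multiset \<Rightarrow> nat" where
  "d_minus d g = Min (d ` set_mset g)"

definition distinguishable :: "('p \<Rightarrow> nat) \<Rightarrow> 'p multiset \<Rightarrow> bool" where
  "distinguishable d g \<longleftrightarrow> g \<noteq> {#} \<and> (\<exists>!P. P \<in># g \<and> d P = d_minus d g)"

definition P_min :: "('p \<Rightarrow> nat) \<Rightarrow> 'p multiset \<Rightarrow> 'p" where
  "P_min d g = (THE P. P \<in># g \<and> d P = d_minus d g)"

definition DS :: "('p \<Rightarrow> nat) \<Rightarrow> 'p set \<Rightarrow> 'p multiset set" where
  "DS d S = {g. distinguishable d g \<and> P_min d g \<in> S} \<union> {{#}}"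

definition moebius :: "'p multiset \<Rightarrow> int" where
  "moebius g = (if \<forall>P. count g P \<le> 1 then (-1) ^ size g else 0)"

definition mconv :: "('p multiset \<Rightarrow> complex) \<Rightarrow> 'p multiset \<Rightarrow> complex" where
  "mconv a g = (\<Sum>h\<in>{h. h \<subseteq># g}. of_int (moebius h) * a (g - h))"

definition gnorm :: "('p \<Rightarrow> nat) \<Rightarrow> real \<Rightarrow> 'p multiset \<Rightarrow> real" where
  "gnorm d q g = q ^ deg d g"

end

theory Submission
  imports Defs "HOL-Complex_Analysis.Complex_Analysis"
begin

text \<open>
  Let \<open>M(m, x)\<close> be the sum of \<open>\<mu>(h) / |h|\<close> over all \<open>h\<close> of degree at most \<open>x\<close> whose primes all have
  degree greater than \<open>m\<close>, and put \<open>\<phi>(m) = \<pi>(m) / q^m\<close>. Sorting by the smallest prime turns the sum in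
  question into \<open>\<Sum>\<^sub>m \<delta>\<^sub>m \<phi>(m) M(m, n - m)\<close>, where \<open>\<delta>\<^sub>m\<close> is the proportion of \<open>S\<close> among the primes of degree
  \<open>m\<close>. By Toeplitz' theorem on weighted means this tends to \<open>\<delta>\<close> as soon as the weights
  \<open>\<phi>(m) M(m, n - m)\<close> tend to 0 for fixed \<open>m\<close>, have bounded total mass, and have sum tending to 1.

  The analytic input is the prime element theorem in the form \<open>\<Sum> |1 - \<Lambda>(k) / q^k| < \<infinity>\<close>. It holds because
  \<open>K(w) = (1 - w) Z(w / q)\<close> is holomorphic beyond the closed unit disc and has no zeros on it: inside, \<open>Z\<close> is an
  exponential; on the circle the 3-4-1 inequality excludes all zeros other than \<open>-1\<close>, which is excluded by
  assumption. Hence \<open>w K' / K\<close>, whose coefficients are \<open>\<Lambda>(k) / q^k - 1\<close>, converges absolutely at \<open>w = 1\<close>.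

  Logarithmic differentiation gives \<open>x M(m, x) = \<Sum>\<^sub>k (1 - \<Lambda>\<^sub>m(k) / q^k) M(m, x - k)\<close>, where \<open>\<Lambda>\<^sub>m\<close> only counts
  primes of degree greater than \<open>m\<close>. The coefficients are 1 for \<open>k \<le> m\<close> and summable, uniformly in \<open>m\<close>, for
  \<open>k > m\<close>; so \<open>M\<close> is bounded and \<open>M(m, x) = O((m + 1) / x)\<close>. With \<open>\<phi>(m) = O(1 / m)\<close> this yields the three
  Toeplitz conditions. For general \<open>a\<close>, each \<open>k \<noteq> e\<close> contributes \<open>a(k) / |k|\<close> times a bounded factor tending to 0.
\<close>

section \<open>Logarithmic coefficients of a power series with a simple pole\<close>

lemma fps_conv_radius_ge_of_geometric_bound:
  fixes f :: "complex fps"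
  assumes b: "b > 0" and bound: "\<And>n. norm (fps_nth f n) \<le> C * b ^ n"
  shows "fps_conv_radius f \<ge> ereal (1 / b)"
  unfolding fps_conv_radius_def
proof (rule conv_radius_geI_ex)
  fix r :: real assume r: "0 < r" "ereal r < ereal (1 / b)"
  have br: "norm (b * r) < 1" using r b by (simp add: field_simps)
  have "summable (\<lambda>n. fps_nth f n * of_real r ^ n)"
  proof (rule summable_comparison_test')
    show "summable (\<lambda>n. C * (b * r) ^ n)"
      using br by (intro summable_mult summable_geometric)
    show "norm (fps_nth f n * of_real r ^ n) \<le> C * (b * r) ^ n" if "n \<ge> 0" for n
      using mult_right_mono[OF bound[of n], of "r ^ n"] r
      by (simp add: norm_mult norm_power power_mult_distrib mult_ac)
  qed
  thus "\<exists>z. norm z = r \<and> summable (\<lambda>n. fps_nth f n * z ^ n)"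
    using r by (intro exI[of _ "of_real r"]) auto
qed

text \<open>The closed unit disc is compact and lies in the open set where \<open>f\<close> does not
  vanish, so this set contains a whole \<open>e\<close>-neighbourhood of the disc.\<close>

lemma nonvanishing_on_larger_ball:
  fixes f :: "complex \<Rightarrow> complex"
  assumes cont: "continuous_on (ball 0 R) f" and R: "R > 1"
    and nz: "\<And>z. norm z \<le> 1 \<Longrightarrow> f z \<noteq> 0"
  obtains r where "1 < r" "r \<le> R" "\<And>z. norm z < r \<Longrightarrow> f z \<noteq> 0"
proof -
  define U where "U = ball 0 R \<inter> f -` (-{0})"
  have "open U" unfolding U_def
    using cont by (intro continuous_open_preimage) auto
  moreover have "cball 0 1 \<subseteq> U" using R nz by (auto simp: U_def)
  ultimately obtain e where e: "e > 0" "(\<Union>x\<in>cball 0 1. ball x e) \<subseteq> U"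
    using compact_subset_open_imp_ball_epsilon_subset[of "cball 0 1" U] by auto
  have "f z \<noteq> 0" if z: "norm z < 1 + e" for z
  proof (cases "norm z \<le> 1")
    case False
    \<comment> \<open>The radial projection to the unit circle witnesses that \<open>z\<close> lies
      within \<open>e\<close> of the closed disc.\<close>
    have "dist (z / of_real (norm z)) z = norm z - 1"
    proof -
      have "z / of_real (norm z) - z = z / of_real (norm z) * of_real (1 - norm z)"
        using False by (cases "z = 0") (simp_all add: divide_simps algebra_simps)
      also have "norm \<dots> = \<bar>1 - norm z\<bar>"
        using False by (auto simp: norm_mult norm_divide simp del: of_real_diff)
      finally show ?thesis using False by (simp add: dist_norm)
    qed
    moreover have "z / of_real (norm z) \<in> cball 0 1" by (simp add: norm_divide)
    ultimately have "z \<in> U" using e z by force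
    thus ?thesis by (simp add: U_def)
  qed (use nz in auto)
  thus ?thesis using e R that[of "min (1 + e) R"] by auto
qed

text \<open>Rescaling by \<open>q\<close> moves the pole of the zeta function to 1:
  \<open>g n\<close> stands for G#(n) / q^n, \<open>l k\<close> for \<Lambda>(k) / q^k, and
  \<open>\<beta>\<close> for q^(\<eta> - 1). The assumption \<open>log_rec\<close> is the
  coefficient form of w Z' = Z (w L') with L = log Z.\<close>

locale zeta_series =
  fixes g l :: "nat \<Rightarrow> real" and c C \<beta> :: real
  assumes g0: "g 0 = 1" and g_nonneg: "\<And>n. g n \<ge> 0" and l_nonneg: "\<And>n. l n \<ge> 0"
    and log_rec: "\<And>n. real n * g n = (\<Sum>k=1..n. l k * g (n - k))"
    and approx: "\<And>n. \<bar>g n - c\<bar> \<le> C * \<beta> ^ n"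
    and \<beta>: "0 < \<beta>" "\<beta> < 1" and c_pos: "c > 0"
begin

definition Zf :: "complex fps" where "Zf = Abs_fps (\<lambda>n. of_real (g n))"
text \<open>Division by 0 gives 0 at \<open>n = 0\<close>, so this logarithm has constant term 0, in
  agreement with \<open>g 0 = 1\<close>.\<close>

definition Lf :: "complex fps" where "Lf = Abs_fps (\<lambda>n. of_real (l n / real n))"
definition Kf :: "complex fps" where "Kf = (1 - fps_X) * Zf"

lemma C_nonneg: "C \<ge> 0"
  using approx[of 0] by simp

lemma Kf_nth: "fps_nth Kf n = of_real (g n - (if n = 0 then 0 else g (n - 1)))"
  by (simp add: Kf_def Zf_def algebra_simps)

text \<open>The limit \<open>c\<close> cancels in \<open>g n - g (n - 1)\<close>, which leaves two
  geometric errors. In the constant, 1 covers the coefficient at 0 and \<open>C / \<beta>\<close>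
  absorbs the index shift.\<close>

lemma Kf_radius: "fps_conv_radius Kf \<ge> ereal (1 / \<beta>)"
proof (rule fps_conv_radius_ge_of_geometric_bound)
  fix n show "norm (fps_nth Kf n) \<le> (1 + C + C / \<beta>) * \<beta> ^ n"
  proof (cases n)
    case 0
    thus ?thesis using C_nonneg \<beta> by (simp add: Kf_nth g0)
  next
    case (Suc m)
    have "\<bar>g n - g m\<bar> \<le> C * \<beta> ^ n + C * \<beta> ^ m"
      using approx[of n] approx[of m] by linarith
    also have "\<dots> \<le> (1 + C + C / \<beta>) * \<beta> ^ n"
      using \<beta> C_nonneg by (simp add: Suc field_simps)
    finally show ?thesis using Suc by (simp add: Kf_nth del: of_real_diff)
  qed
qed (use \<beta> in auto)

lemma Zf_radius: "fps_conv_radius Zf \<ge> ereal 1"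
proof -
  have "fps_conv_radius Zf \<ge> ereal (1 / 1)"
  proof (rule fps_conv_radius_ge_of_geometric_bound)
    fix n
    have "C * \<beta> ^ n \<le> C * 1" using \<beta> C_nonneg by (intro mult_left_mono power_le_one) auto
    thus "norm (fps_nth Zf n) \<le> (c + C) * 1 ^ n"
      using approx[of n] g_nonneg[of n] by (simp add: Zf_def)
  qed auto
  thus ?thesis by simp
qed

text \<open>The term \<open>k = n\<close> of \<open>log_rec\<close> is \<open>l n\<close>, and all
  the others are nonnegative. This bounds the coefficients of \<open>Lf\<close>.\<close>

lemma l_div_le: "l n / real n \<le> g n"
proof (cases "n = 0")
  case False
  have "l n * g (n - n) \<le> (\<Sum>k=1..n. l k * g (n - k))"
    using False by (intro member_le_sum) (auto intro!: mult_nonneg_nonneg l_nonneg g_nonneg)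
  thus ?thesis using False log_rec[of n] by (simp add: g0 field_simps)
qed (use g_nonneg in auto)

lemma Lf_radius: "fps_conv_radius Lf \<ge> ereal 1"
proof -
  have "fps_conv_radius Lf \<ge> ereal (1 / 1)"
  proof (rule fps_conv_radius_ge_of_geometric_bound)
    fix n
    have "C * \<beta> ^ n \<le> C * 1" using \<beta> C_nonneg by (intro mult_left_mono power_le_one) auto
    thus "norm (fps_nth Lf n) \<le> (c + C) * 1 ^ n"
      using approx[of n] l_div_le[of n] l_nonneg[of n] unfolding Lf_def
      by (simp add: norm_divide)
  qed auto
  thus ?thesis by simp
qed

section \<open>The exponential formula for the zeta series and the function
  \<open>Kf\<close>\<close>

lemma Zf_deriv: "fps_deriv Zf = Zf * fps_deriv Lf"
proof (rule fps_ext)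
  fix n
  have "fps_nth (fps_deriv Zf) n = of_real (real (Suc n) * g (Suc n))"
    by (simp add: Zf_def)
  also have "real (Suc n) * g (Suc n) = (\<Sum>k=1..Suc n. l k * g (Suc n - k))"
    by (rule log_rec)
  also have "\<dots> = (\<Sum>i=0..n. g i * l (Suc n - i))"
    by (rule sum.reindex_bij_witness[of _ "\<lambda>i. Suc n - i" "\<lambda>k. Suc n - k"]) auto
  also have "of_real \<dots> = fps_nth (Zf * fps_deriv Lf) n"
    unfolding of_real_sum fps_mult_nth
  proof (intro sum.cong refl)
    fix i assume "i \<in> {0..n}"
    hence "Suc n - i = Suc (n - i)" by auto
    moreover have "of_nat (Suc (n - i)) * (of_real (l (Suc (n - i))) / of_nat (Suc (n - i))) =
        (of_real (l (Suc (n - i))) :: complex)"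
      by (simp del: of_nat_Suc)
    ultimately show "of_real (g i * l (Suc n - i)) = fps_nth Zf i * fps_nth (fps_deriv Lf) (n - i)"
      by (simp add: Zf_def Lf_def del: of_nat_Suc)
  qed
  finally show "fps_nth (fps_deriv Zf) n = fps_nth (Zf * fps_deriv Lf) n" .
qed

text \<open>By \<open>Zf_deriv\<close> the product of Z and exp (- L) has derivative 0 on the unit
  disc, and its value at 0 is 1. In particular Z has no zeros there.\<close>

lemma Zf_eq_exp:
  assumes z: "norm z < 1"
  shows "eval_fps Zf z = exp (eval_fps Lf z)"
proof -
  have rad: "ereal (norm w) < fps_conv_radius Zf" "ereal (norm w) < fps_conv_radius Lf"
    "ereal (norm w) < fps_conv_radius (fps_deriv Lf)" if "norm w < 1" for w :: complex
  proof -
    have "ereal (norm w) < ereal 1" using that by simp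
    thus "ereal (norm w) < fps_conv_radius Zf" "ereal (norm w) < fps_conv_radius Lf"
      "ereal (norm w) < fps_conv_radius (fps_deriv Lf)"
      using Zf_radius Lf_radius fps_conv_radius_deriv[of Lf] by (meson less_le_trans order_trans)+
  qed
  define F where "F = (\<lambda>w. eval_fps Zf w * exp (- eval_fps Lf w))"
  have "(F has_field_derivative 0) (at w within ball 0 1)" if "w \<in> ball 0 1" for w
  proof -
    have w: "norm w < 1" using that by simp
    note deriv = has_field_derivative_eval_fps[OF rad(1)[OF w]] has_field_derivative_eval_fps[OF rad(2)[OF w]]
    have "(F has_field_derivative (eval_fps (fps_deriv Zf) w * exp (- eval_fps Lf w) +
            exp (- eval_fps Lf w) * (- eval_fps (fps_deriv Lf) w) * eval_fps Zf w)) (at w within ball 0 1)"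
      unfolding F_def by (auto intro!: derivative_eq_intros deriv rad w)
    thus ?thesis
      unfolding Zf_deriv eval_fps_mult[OF rad(1,3)[OF w]]
      by (simp add: algebra_simps)
  qed
  hence "\<exists>k. \<forall>w\<in>ball 0 1. F w = k"
    by (intro has_field_derivative_zero_constant) auto
  then obtain k where k: "\<forall>w\<in>ball 0 1. F w = k" by blast
  have "F z = F 0" using k z by simp
  also have "F 0 = 1" by (simp add: F_def eval_fps_at_0 Zf_def Lf_def g0)
  finally show ?thesis by (simp add: F_def exp_minus field_simps)
qed

lemma Kf_eq:
  assumes "norm z < 1"
  shows "eval_fps Kf z = (1 - z) * eval_fps Zf z"
proof -
  have "ereal (norm z) < fps_conv_radius Zf"
    using assms Zf_radius by (meson less_ereal.simps(1) less_le_trans)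
  moreover have "ereal (norm z) < fps_conv_radius (1 - fps_X :: complex fps)"
    using fps_conv_radius_diff[of "1 :: complex fps" fps_X] by simp
  ultimately show ?thesis
    by (simp add: Kf_def eval_fps_mult eval_fps_diff)
qed

text \<open>The partial sums of the coefficients of \<open>Kf\<close> telescope to
  \<open>g N\<close>, which tends to \<open>c\<close>.\<close>

lemma Kf_at_1: "eval_fps Kf 1 = of_real c"
proof -
  have "(\<lambda>n. C * \<beta> ^ n) \<longlonglongrightarrow> 0"
    using \<beta> by (intro tendsto_mult_right_zero LIMSEQ_realpow_zero) auto
  hence "(\<lambda>n. g n - c) \<longlonglongrightarrow> 0"
    by (rule Lim_null_comparison[rotated]) (simp add: approx)
  hence "g \<longlonglongrightarrow> c" by (simp add: LIM_zero_iff)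
  moreover have "(\<Sum>n<Suc N. g n - (if n = 0 then 0 else g (n - 1))) = g N" for N
    by (induction N) auto
  ultimately have "(\<lambda>N. \<Sum>n<Suc N. g n - (if n = 0 then 0 else g (n - 1))) \<longlonglongrightarrow> c" by simp
  hence "(\<lambda>n. g n - (if n = 0 then 0 else g (n - 1))) sums c"
    unfolding sums_def by (subst (asm) filterlim_sequentially_Suc)
  hence "(\<lambda>n. complex_of_real (g n - (if n = 0 then 0 else g (n - 1)))) sums of_real c"
    by (subst sums_of_real_iff)
  thus ?thesis unfolding eval_fps_def Kf_nth
    by (simp add: sums_iff del: of_real_diff)
qed

lemma radius_gt_1: "norm z \<le> 1 \<Longrightarrow> ereal (norm z) < fps_conv_radius Kf"
proof -
  assume "norm z \<le> 1"
  moreover have "1 < 1 / \<beta>" using \<beta> by simp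
  ultimately have "ereal (norm z) < ereal (1 / \<beta>)" by (simp only: less_ereal.simps)
  thus ?thesis using Kf_radius by (rule less_le_trans)
qed

text \<open>The coefficients of \<open>log Z\<close> are nonnegative and \<open>Re (3 + 4 u + u^2) = 2 (1 + Re u)^2\<close> for \<open>|u| = 1\<close>.\<close>
lemma three_four_one:
  assumes r: "0 < r" "r < 1" and \<zeta>: "norm \<zeta> = 1"
  shows "1 \<le> norm (eval_fps Zf (of_real r)) ^ 3 * norm (eval_fps Zf (of_real r * \<zeta>)) ^ 4 *
              norm (eval_fps Zf (of_real r * \<zeta>\<^sup>2))"
proof -
  have n: "norm (complex_of_real r) < 1" "norm (complex_of_real r * \<zeta>) < 1"
    "norm (complex_of_real r * \<zeta>\<^sup>2) < 1"
    using r \<zeta> by (auto simp: norm_mult norm_power)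
  have s: "(\<lambda>n. Re (fps_nth Lf n * z ^ n)) sums Re (eval_fps Lf z)" if "norm z < 1" for z
    using that Lf_radius
    by (intro sums_Re sums_eval_fps) (meson less_ereal.simps(1) less_le_trans)
  have sums: "(\<lambda>n. 3 * Re (fps_nth Lf n * of_real r ^ n) + 4 * Re (fps_nth Lf n * (of_real r * \<zeta>) ^ n)
          + Re (fps_nth Lf n * (of_real r * \<zeta>\<^sup>2) ^ n)) sums
        (3 * Re (eval_fps Lf (of_real r)) + 4 * Re (eval_fps Lf (of_real r * \<zeta>))
          + Re (eval_fps Lf (of_real r * \<zeta>\<^sup>2)))"
    by (intro sums_add sums_mult s n)
  have "0 \<le> 3 * Re (fps_nth Lf n * of_real r ^ n) + 4 * Re (fps_nth Lf n * (of_real r * \<zeta>) ^ n)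
          + Re (fps_nth Lf n * (of_real r * \<zeta>\<^sup>2) ^ n)" for n
  proof -
    define x where "x = Re (\<zeta> ^ n)"
    define y where "y = Im (\<zeta> ^ n)"
    define t where "t = l n / real n * r ^ n"
    have "norm (\<zeta> ^ n) = 1" using \<zeta> by (simp add: norm_power)
    hence xy: "x\<^sup>2 + y\<^sup>2 = 1" unfolding x_def y_def by (simp add: cmod_def)
    have "Re ((\<zeta>\<^sup>2) ^ n) = x\<^sup>2 - y\<^sup>2"
      unfolding x_def y_def by (simp add: power2_eq_square power_mult_distrib)
    hence sq: "Re ((\<zeta>\<^sup>2) ^ n) = 2 * x\<^sup>2 - 1" using xy by simp
    have *: "Re (fps_nth Lf n * (of_real r * w) ^ n) = t * Re (w ^ n)" for w
    proof -
      have "fps_nth Lf n * (of_real r * w) ^ n = of_real t * w ^ n"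
        by (simp add: Lf_def t_def power_mult_distrib)
      thus ?thesis by simp
    qed
    have "t \<ge> 0" using l_nonneg r by (simp add: t_def)
    hence "0 \<le> t * (2 * (1 + x)\<^sup>2)" by simp
    also have "\<dots> = 3 * (t * 1) + 4 * (t * x) + t * (2 * x\<^sup>2 - 1)"
      by (simp add: power2_eq_square algebra_simps)
    finally show ?thesis using *[of 1] *[of \<zeta>] *[of "\<zeta>\<^sup>2"] sq by (simp add: x_def)
  qed
  from sums_le[OF this sums_zero sums] have "0 \<le> 3 * Re (eval_fps Lf (of_real r)) + 4 * Re (eval_fps Lf (of_real r * \<zeta>))
          + Re (eval_fps Lf (of_real r * \<zeta>\<^sup>2))" .
  hence "1 \<le> exp (3 * Re (eval_fps Lf (of_real r)) + 4 * Re (eval_fps Lf (of_real r * \<zeta>))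
          + Re (eval_fps Lf (of_real r * \<zeta>\<^sup>2)))" by simp
  also have "\<dots> = exp (Re (eval_fps Lf (of_real r))) ^ 3 * exp (Re (eval_fps Lf (of_real r * \<zeta>))) ^ 4
          * exp (Re (eval_fps Lf (of_real r * \<zeta>\<^sup>2)))"
    by (simp add: exp_add flip: exp_of_nat_mult)
  finally show ?thesis
    using n by (simp add: Zf_eq_exp)
qed

text \<open>Suppose K vanishes at \<open>\<zeta>\<close>. As r tends to 1 from below, Z(r) grows
  like 1 / (1 - r), Z(r \<zeta>) is O(1 - r), and Z(r \<zeta>^2) stays bounded because \<zeta>^2 is
  not the pole. The product in \<open>three_four_one\<close> is then O(1 - r), yet it is at least
  1.\<close>

lemma Kf_nonzero_on_circle:
  assumes \<zeta>: "norm \<zeta> = 1" "\<zeta>\<^sup>2 \<noteq> 1"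
  shows "eval_fps Kf \<zeta> \<noteq> 0"
proof
  assume zero: "eval_fps Kf \<zeta> = 0"
  \<comment> \<open>Bookkeeping with \<open>s = 1 - r\<close>: cubing K(r) costs
    \<open>s ^ 3\<close>, the fourth power of the difference quotient returns \<open>s ^ 4\<close>,
    so one factor \<open>s\<close> survives.\<close>
  have cancel: "X ^ 4 * Y * (a ^ 3 * b ^ 4 * e) = (s * a) ^ 3 * (X * b / s) ^ 4 * (Y * e) * s"
    if "s \<noteq> 0" for a b e s X Y :: real
  proof -
    have "(s * a) ^ 3 * (X * b / s) ^ 4 * (Y * e) * s =
        (s ^ 3 * s / s ^ 4) * (X ^ 4 * Y * (a ^ 3 * b ^ 4 * e))"
      unfolding power_mult_distrib power_divide by simp
    also have "s ^ 3 * s / s ^ 4 = 1" using that by (simp add: power4_eq_xxxx power3_eq_cube)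
    finally show ?thesis by (simp only: mult_1)
  qed
  define D where "D = eval_fps (fps_deriv Kf) \<zeta>"
  have lim: "((\<lambda>r::real. of_real r * w) \<longlongrightarrow> w) (at_left 1)" for w :: complex
    by (auto intro!: tendsto_eq_intros)
  have K: "((\<lambda>r::real. eval_fps Kf (of_real r * w)) \<longlongrightarrow> eval_fps Kf w) (at_left 1)"
    if "norm w = 1" for w
    using that by (intro isCont_tendsto_compose[OF _ lim] continuous_eval_fps radius_gt_1) auto
  have "(eval_fps Kf has_field_derivative D) (at \<zeta>)"
    unfolding D_def using \<zeta> by (intro has_field_derivative_eval_fps radius_gt_1) auto
  hence "((\<lambda>w. (eval_fps Kf w - eval_fps Kf \<zeta>) / (w - \<zeta>)) \<longlongrightarrow> D) (at \<zeta>)"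
    by (simp add: has_field_derivative_iff)
  moreover have "filterlim (\<lambda>r::real. of_real r * \<zeta>) (at \<zeta>) (at_left 1)"
  proof -
    have "\<zeta> \<noteq> 0" using \<zeta> by auto
    thus ?thesis using lim[of \<zeta>] by (auto simp: filterlim_at eventually_at_filter)
  qed
  ultimately have "((\<lambda>r::real. (eval_fps Kf (of_real r * \<zeta>) - eval_fps Kf \<zeta>) / (of_real r * \<zeta> - \<zeta>)) \<longlongrightarrow> D) (at_left 1)"
    by (rule filterlim_compose)
  hence quot: "((\<lambda>r::real. norm ((eval_fps Kf (of_real r * \<zeta>) - eval_fps Kf \<zeta>) / (of_real r * \<zeta> - \<zeta>))) \<longlongrightarrow> norm D) (at_left 1)"
    by (rule tendsto_norm)
  have one: "((\<lambda>r::real. eval_fps Kf (of_real r)) \<longlongrightarrow> eval_fps Kf 1) (at_left 1)"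
    using K[of 1] by simp
  have r1: "((\<lambda>r::real. 1 - r) \<longlongrightarrow> 0) (at_left 1)"
    by (auto intro!: tendsto_eq_intros)
  \<comment> \<open>The other factors merely converge; the surviving \<open>1 - r\<close> forces the
    limit 0.\<close>
  have "((\<lambda>r::real. norm (eval_fps Kf (of_real r)) ^ 3 *
      norm ((eval_fps Kf (of_real r * \<zeta>) - eval_fps Kf \<zeta>) / (of_real r * \<zeta> - \<zeta>)) ^ 4 *
      norm (eval_fps Kf (of_real r * \<zeta>\<^sup>2)) * (1 - r)) \<longlongrightarrow>
      norm (eval_fps Kf 1) ^ 3 * norm D ^ 4 * norm (eval_fps Kf (\<zeta>\<^sup>2)) * 0) (at_left 1)"
    using \<zeta> by (intro tendsto_mult tendsto_power tendsto_norm quot r1 K one) (auto simp: norm_power)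
  moreover have "((\<lambda>r::real. norm (1 - of_real r * \<zeta>) ^ 4 * norm (1 - of_real r * \<zeta>\<^sup>2)) \<longlongrightarrow>
      norm (1 - \<zeta>) ^ 4 * norm (1 - \<zeta>\<^sup>2)) (at_left 1)"
    by (intro tendsto_mult tendsto_power tendsto_norm tendsto_diff tendsto_const lim)
  moreover have "\<forall>\<^sub>F r::real in at_left 1. norm (1 - of_real r * \<zeta>) ^ 4 * norm (1 - of_real r * \<zeta>\<^sup>2) \<le>
      norm (eval_fps Kf (of_real r)) ^ 3 *
      norm ((eval_fps Kf (of_real r * \<zeta>) - eval_fps Kf \<zeta>) / (of_real r * \<zeta> - \<zeta>)) ^ 4 *
      norm (eval_fps Kf (of_real r * \<zeta>\<^sup>2)) * (1 - r)"
  proof -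
    have "\<forall>\<^sub>F r::real in at_left 1. r \<in> {0<..<1}"
      by (rule eventually_at_left_real) simp
    thus ?thesis
    proof eventually_elim
      case (elim r)
      hence r: "0 < r" "r < 1" by auto
      have n: "norm (complex_of_real r) < 1" "norm (complex_of_real r * \<zeta>) < 1"
        "norm (complex_of_real r * \<zeta>\<^sup>2) < 1"
        using r \<zeta> by (auto simp: norm_mult norm_power)
      have e: "of_real r * \<zeta> - \<zeta> = - (of_real (1 - r) * \<zeta>)" by (simp add: algebra_simps)
      have q: "norm ((eval_fps Kf (of_real r * \<zeta>) - eval_fps Kf \<zeta>) / (of_real r * \<zeta> - \<zeta>)) =
          norm (eval_fps Kf (of_real r * \<zeta>)) / (1 - r)"
        unfolding e zero norm_divide norm_minus_cancel norm_mult norm_of_real using r \<zeta> by simp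
      have w: "norm (1 - complex_of_real r) = 1 - r"
        using r by (metis abs_of_pos diff_gt_0_iff_gt norm_of_real of_real_1 of_real_diff)
      have "norm (1 - of_real r * \<zeta>) ^ 4 * norm (1 - of_real r * \<zeta>\<^sup>2) * 1 \<le>
        norm (1 - of_real r * \<zeta>) ^ 4 * norm (1 - of_real r * \<zeta>\<^sup>2) *
        (norm (eval_fps Zf (of_real r)) ^ 3 * norm (eval_fps Zf (of_real r * \<zeta>)) ^ 4 *
              norm (eval_fps Zf (of_real r * \<zeta>\<^sup>2)))"
        by (intro mult_left_mono three_four_one r \<zeta>) auto
      also have "\<dots> = norm (eval_fps Kf (of_real r)) ^ 3 *
      (norm (eval_fps Kf (of_real r * \<zeta>)) / (1 - r)) ^ 4 *
      norm (eval_fps Kf (of_real r * \<zeta>\<^sup>2)) * (1 - r)"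
        unfolding Kf_eq[OF n(1)] Kf_eq[OF n(2)] Kf_eq[OF n(3)] norm_mult w
        using r by (intro cancel) simp
      finally show ?case unfolding q by simp
    qed
  qed
  ultimately have "norm (1 - \<zeta>) ^ 4 * norm (1 - \<zeta>\<^sup>2) \<le> 
      norm (eval_fps Kf 1) ^ 3 * norm D ^ 4 * norm (eval_fps Kf (\<zeta>\<^sup>2)) * 0"
    using tendsto_le trivial_limit_at_left_real by blast
  moreover have "norm (1 - \<zeta>) ^ 4 * norm (1 - \<zeta>\<^sup>2) > 0" using \<zeta> by (auto intro!: mult_pos_pos)
  ultimately show False by simp
qed

lemma abs_summable_log_coeffs:
  assumes nz: "eval_fps Kf (-1) \<noteq> 0"
  shows "summable (\<lambda>n. \<bar>1 - l (Suc n)\<bar>)"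
proof -
  have "eval_fps Kf z \<noteq> 0" if "norm z \<le> 1" for z
  proof (cases "norm z < 1")
    case True
    thus ?thesis by (auto simp: Kf_eq Zf_eq_exp)
  next
    case False
    hence n1: "norm z = 1" using that by simp
    show ?thesis
    proof (cases "z\<^sup>2 = 1")
      case True
      hence "z = 1 \<or> z = -1" by (simp add: power2_eq_1_iff)
      thus ?thesis using nz c_pos by (auto simp: Kf_at_1)
    qed (use Kf_nonzero_on_circle n1 in auto)
  qed
  moreover have ballR: "ball 0 (1 / \<beta>) \<subseteq> eball 0 (fps_conv_radius Kf)"
    using Kf_radius by (rule ball_eball_mono)
  moreover have "continuous_on (ball 0 (1 / \<beta>)) (eval_fps Kf)"
    using ballR by (rule continuous_on_subset[OF continuous_on_eval_fps])
  ultimately obtain r where r: "1 < r" "r \<le> 1 / \<beta>" "\<And>z. norm z < r \<Longrightarrow> eval_fps Kf z \<noteq> 0"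
    using nonvanishing_on_larger_ball[of "1 / \<beta>" "eval_fps Kf"] \<beta> by auto
  define h where "h = (\<lambda>z. z * eval_fps (fps_deriv Kf) z / eval_fps Kf z)"
  have sub: "ball 0 r \<subseteq> ball (0::complex) (1 / \<beta>)" using r by auto
  have radr: "ereal (norm z) < fps_conv_radius Kf" "ereal (norm z) < fps_conv_radius (fps_deriv Kf)"
    if "norm z < r" for z :: complex
  proof -
    have "z \<in> eball 0 (fps_conv_radius Kf)" using sub ballR that by (auto simp del: in_eball_iff)
    thus "ereal (norm z) < fps_conv_radius Kf" by simp
    thus "ereal (norm z) < fps_conv_radius (fps_deriv Kf)"
      using fps_conv_radius_deriv[of Kf] by (rule less_le_trans)
  qed
  have holo: "h holomorphic_on eball 0 (ereal r)"
    unfolding h_def eball_ereal using r(3)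
    by (intro holomorphic_intros) (auto intro: radr)
  define V where "V = fps_expansion h 0"
  have V: "fps_conv_radius V \<ge> ereal r" "\<And>z. norm z < r \<Longrightarrow> eval_fps V z = h z"
    using conv_radius_fps_expansion[OF holo] eval_fps_expansion'[OF holo] by (auto simp: V_def)
  have radK: "fps_conv_radius Kf > 0" "fps_conv_radius (fps_deriv Kf) > 0"
    using radr[of 0] r by (auto simp: zero_ereal_def)
  have radV: "fps_conv_radius V > 0" using V(1) r(1) by (metis ereal_less(2) less_le_trans less_trans zero_less_one)
  \<comment> \<open>The equation h K = z K' holds on a disc around 0 and hence between the power
    series.\<close>
  have VK: "V * Kf = fps_X * fps_deriv Kf"
  proof (rule eval_fps_eqD)
    show "fps_conv_radius (V * Kf) > 0"
      using fps_conv_radius_mult[of V Kf] radV radK by (meson less_le_trans min_less_iff_conj)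
    show "fps_conv_radius (fps_X * fps_deriv Kf) > 0"
      using fps_conv_radius_mult[of fps_X "fps_deriv Kf"] radK by (auto simp: min_def split: if_splits)
    have "eval_fps (V * Kf) z = eval_fps (fps_X * fps_deriv Kf) z" if z: "norm z < r" for z
    proof -
      have "ereal (norm z) < fps_conv_radius V"
        using z V(1) by (meson ereal_less_eq(3) less_ereal.simps(1) less_le_trans)
      thus ?thesis using radr[OF z] V(2)[OF z] r(3)[OF z] by (simp add: eval_fps_mult h_def)
    qed
    moreover have "\<forall>\<^sub>F z in nhds 0. z \<in> ball (0::complex) r"
      using r by (intro eventually_nhds_in_open) auto
    ultimately show "\<forall>\<^sub>F z in nhds 0. eval_fps (V * Kf) z = eval_fps (fps_X * fps_deriv Kf) z"
      by (auto elim!: eventually_mono)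
  qed
  \<comment> \<open>The factor 1 - X turns the stray \<open>Zf\<close> into \<open>Kf\<close>, which
    can then be cancelled. What remains is (1 - X)(X L' - V) = X, so X L' - V = X / (1 - X) has
    coefficient 1 at every positive index.\<close>
  have "fps_deriv Kf = (1 - fps_X) * (Zf * fps_deriv Lf) - Zf"
    by (simp add: Kf_def Zf_deriv algebra_simps)
  hence "(1 - fps_X) * (V * Kf) =
      (1 - fps_X) * (fps_X * ((1 - fps_X) * (Zf * fps_deriv Lf) - Zf))"
    unfolding VK by simp
  also have "\<dots> = (fps_X * fps_deriv Lf * (1 - fps_X) - fps_X) * Kf"
    unfolding Kf_def by (simp add: algebra_simps)
  finally have "(1 - fps_X) * (V * Kf) = (fps_X * fps_deriv Lf * (1 - fps_X) - fps_X) * Kf" .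
  hence "((1 - fps_X) * V) * Kf = (fps_X * fps_deriv Lf * (1 - fps_X) - fps_X) * Kf"
    by (simp add: mult_ac)
  moreover have "Kf \<noteq> 0" using r(3)[of 0] r(1) by auto
  ultimately have eq: "(1 - fps_X) * V = (1 - fps_X) * (fps_X * fps_deriv Lf) - fps_X"
    by (simp add: mult_ac)
  have "(1 - fps_X) * (fps_X * fps_deriv Lf - V) = fps_X"
    using eq by (simp add: algebra_simps)
  moreover have "(1 - fps_X) * Abs_fps (\<lambda>n. if n = 0 then 0 else 1 :: complex) = fps_X"
    unfolding left_diff_distrib by (rule fps_ext) auto
  moreover have "(1 - fps_X :: complex fps) \<noteq> 0"
  proof
    assume "(1 - fps_X :: complex fps) = 0"
    from arg_cong[OF this, of "\<lambda>f. fps_nth f 0"] show False by simp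
  qed
  ultimately have eq2: "fps_X * fps_deriv Lf - V = Abs_fps (\<lambda>n. if n = 0 then 0 else 1)"
    by (metis mult_left_cancel)
  have "norm (fps_nth V (Suc n)) = \<bar>1 - l (Suc n)\<bar>" for n
  proof -
    have "of_real (l (Suc n)) - fps_nth V (Suc n) = 1"
      using arg_cong[OF eq2, of "\<lambda>f. fps_nth f (Suc n)"] by (simp add: Lf_def del: of_nat_Suc)
    hence "fps_nth V (Suc n) = of_real (l (Suc n) - 1)" by (simp add: algebra_simps)
    thus ?thesis by (simp del: of_real_diff)
  qed
  moreover have "summable (\<lambda>n. norm (fps_nth V n * 1 ^ n))"
    using V(1) r(1) by (intro norm_summable_fps less_le_trans[OF _ V(1)]) simp
  hence "summable (\<lambda>n. norm (fps_nth V (Suc n)))"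
    by (subst summable_Suc_iff) simp
  ultimately show ?thesis by simp
qed

end

section \<open>Recursions for degree-graded sums\<close>

lemma deg_empty [simp]: "deg d {#} = 0"
  by (simp add: deg_def)

lemma deg_add_mset [simp]: "deg d (add_mset P g) = d P + deg d g"
  by (simp add: deg_def)

lemma deg_union [simp]: "deg d (g + h) = deg d g + deg d h"
  by (simp add: deg_def)

lemma le_deg: "P \<in># g \<Longrightarrow> d P \<le> deg d g"
  by (metis deg_add_mset insert_DiffM le_add1)

lemma deg_eq_sum_count: "deg d g = (\<Sum>P\<in>set_mset g. d P * count g P)"
proof -
  \<comment> \<open>A fixed finite superset \<open>A\<close> keeps the index set constant while
    \<open>g\<close> grows in the induction.\<close>
  have "set_mset g \<subseteq> A \<Longrightarrow> finite A \<Longrightarrow> deg d g = (\<Sum>P\<in>A. d P * count g P)" for A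
  proof (induction g)
    case (add Q g)
    have "d P * count (add_mset Q g) P = d P * count g P + (if P = Q then d P else 0)" for P
      by simp
    thus ?case using add by (simp add: sum.distrib)
  qed simp
  thus ?thesis by simp
qed

lemma moebius_empty [simp]: "moebius {#} = 1"
  by (simp add: moebius_def)

lemma moebius_add_mset: "moebius (add_mset P h) = (if P \<in># h then 0 else - moebius h)"
proof (cases "P \<in># h")
  case True
  hence "\<not> count (add_mset P h) P \<le> 1" by simp
  thus ?thesis using True unfolding moebius_def by (metis (full_types))
next
  case False
  hence "count h P = 0" by (simp add: not_in_iff)
  hence "(\<forall>Q. count (add_mset P h) Q \<le> 1) \<longleftrightarrow> (\<forall>Q. count h Q \<le> 1)"
    by (metis One_nat_def count_add_mset le_SucI le_refl zero_le)
  thus ?thesis using False by (simp add: moebius_def)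
qed

lemma moebius_mset_set_union:
  assumes "finite J" "J \<inter> set_mset h = {}"
  shows "moebius (mset_set J + h) = (-1) ^ card J * moebius h"
  using assms by (induction J rule: finite_induct) (auto simp: moebius_add_mset)

text \<open>Unrolling the recursion descends in steps of \<open>D\<close> and collects one value of
  \<open>f\<close> at each positive multiple of \<open>D\<close> up to \<open>n\<close>. It is used
  with the degree of a prime as \<open>D\<close>.\<close>

lemma sum_dvd_recursion:
  fixes c f :: "nat \<Rightarrow> real"
  assumes D: "D > 0" and rec: "\<And>n. c n = (if D \<le> n then c (n - D) + f (n - D) else 0)"
  shows "c n = (\<Sum>k | k \<in> {1..n} \<and> D dvd k. f (n - k))"
proof (induction n rule: less_induct)
  case (less n)
  show ?case
  proof (cases "D \<le> n")
    case False
    hence "{k \<in> {1..n}. D dvd k} = {}" by (auto dest: dvd_imp_le)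
    thus ?thesis using False by (subst rec) (simp only: sum.empty if_False)
  next
    case True
    have set: "{k \<in> {1..n}. D dvd k} = insert D ((+) D ` {k \<in> {1..n - D}. D dvd k})"
    proof (intro equalityI subsetI)
      fix k assume k: "k \<in> {k \<in> {1..n}. D dvd k}"
      hence "D \<le> k" using D by (auto dest: dvd_imp_le)
      show "k \<in> insert D ((+) D ` {k \<in> {1..n - D}. D dvd k})"
      proof (cases "k = D")
        case False
        hence "k = D + (k - D)" "k - D \<in> {k \<in> {1..n - D}. D dvd k}"
          using k \<open>D \<le> k\<close> by (auto intro: dvd_diff_nat)
        thus ?thesis by blast
      qed auto
    qed (use D True in auto)
    have "(\<Sum>k | k \<in> {1..n} \<and> D dvd k. f (n - k)) =
        f (n - D) + (\<Sum>k | k \<in> {1..n - D} \<and> D dvd k. f (n - (D + k)))"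
      unfolding set by (subst sum.insert) (auto simp: sum.reindex)
    also have "(\<Sum>k | k \<in> {1..n - D} \<and> D dvd k. f (n - (D + k))) = c (n - D)"
      using less.IH[of "n - D"] True D by (simp add: diff_diff_left)
    finally show ?thesis using True by (subst rec) simp
  qed
qed

section \<open>Rough elements and their degree recursions\<close>

locale degree_semigroup =
  fixes d :: "'p \<Rightarrow> nat" and q :: real
  assumes d_pos: "d P > 0" and finite_deg_le: "finite {g :: 'p multiset. deg d g \<le> x}"
    and q_gt_1: "q > 1"
begin

lemma q_pos: "q > 0" and q_ne_0 [simp]: "q \<noteq> 0"
  using q_gt_1 by auto

lemma deg_eq_0_iff [simp]: "deg d g = 0 \<longleftrightarrow> g = {#}"
  using le_deg[of _ g d] d_pos by (metis deg_empty le_zero_eq multiset_nonemptyE not_gr_zero)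

definition rough :: "nat \<Rightarrow> nat \<Rightarrow> 'p multiset set" where
  "rough m n = {g. deg d g = n \<and> (\<forall>P\<in>#g. m < d P)}"

text \<open>For \<open>k > 0\<close> this is \<Lambda>_m(k), the coefficient of z^k in z times the
  logarithmic derivative of the Euler product over primes of degree greater than
  \<open>m\<close>.\<close>

definition wt :: "nat \<Rightarrow> nat \<Rightarrow> real" where
  "wt m k = (\<Sum>P | m < d P \<and> d P dvd k. real (d P))"

lemma finite_rough [simp]: "finite (rough m n)"
  by (rule finite_subset[OF _ finite_deg_le[of n]]) (auto simp: rough_def)

lemma finite_primes: "finite {P. d P \<le> n}"
proof -
  have "(\<lambda>P. {#P#}) ` {P. d P \<le> n} \<subseteq> {g. deg d g \<le> n}" by auto
  hence "finite ((\<lambda>P. {#P#}) ` {P. d P \<le> n})" using finite_deg_le finite_subset by blast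
  thus ?thesis by (rule finite_imageD) (auto simp: inj_on_def)
qed

lemma finite_primes_eq [simp]: "finite {P. d P = n}" "finite {P \<in> S. d P = n}"
  by (rule finite_subset[OF _ finite_primes[of n]]; auto)+

lemma finite_dvd_primes: "k > 0 \<Longrightarrow> finite {P. m < d P \<and> d P dvd k}"
  by (rule finite_subset[OF _ finite_primes[of k]]) (auto dest: dvd_imp_le)

text \<open>Both the count of all elements and the Moebius sums satisfy the same recursion: in the former
  case \<open>\<nu> g P\<close> is the multiplicity of \<open>P\<close> in \<open>g\<close>, in the latter the indicator of \<open>P | g\<close> times \<open>\<mu> g\<close>.\<close>
lemma weighted_degree_recursion:
  fixes \<omega> :: "'p multiset \<Rightarrow> real" and \<nu> :: "'p multiset \<Rightarrow> 'p \<Rightarrow> real"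
  assumes \<nu>0: "\<And>g P. P \<notin># g \<Longrightarrow> \<nu> g P = 0"
    and \<nu>_add: "\<And>g P. \<nu> (add_mset P g) P = \<nu> g P + s * \<omega> g"
    and deg: "\<And>g. real (deg d g) * \<omega> g = (\<Sum>P\<in>set_mset g. real (d P) * \<nu> g P)"
  shows "real n * (\<Sum>g\<in>rough m n. \<omega> g) = s * (\<Sum>k=1..n. wt m k * (\<Sum>g\<in>rough m (n - k). \<omega> g))"
proof -
  define W where "W = (\<lambda>n. \<Sum>g\<in>rough m n. \<omega> g)"
  define c where "c = (\<lambda>P n. \<Sum>g\<in>rough m n. \<nu> g P)"
  \<comment> \<open>Removing one copy of \<open>P\<close> maps the elements of degree
    \<open>n\<close> divisible by \<open>P\<close> bijectively to the rough elements of degree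
    \<open>n - d P\<close>.\<close>
  have c_rec: "c P n = (if d P \<le> n then c P (n - d P) + s * W (n - d P) else 0)" if P: "m < d P" for P n
  proof -
    have "c P n = (\<Sum>g | g \<in> rough m n \<and> P \<in># g. \<nu> g P)"
      unfolding c_def by (rule sum.mono_neutral_right) (auto simp: \<nu>0)
    also have "\<dots> = (if d P \<le> n then c P (n - d P) + s * W (n - d P) else 0)"
    proof (cases "d P \<le> n")
      case True
      have "{g \<in> rough m n. P \<in># g} = add_mset P ` rough m (n - d P)"
      proof (intro equalityI subsetI)
        fix g assume g: "g \<in> {g \<in> rough m n. P \<in># g}"
        hence eq: "g = add_mset P (g - {#P#})" by simp
        have "deg d g = d P + deg d (g - {#P#})" by (subst eq) (rule deg_add_mset)
        hence "g - {#P#} \<in> rough m (n - d P)" using g by (auto simp: rough_def dest: in_diffD)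
        thus "g \<in> add_mset P ` rough m (n - d P)" using eq by blast
      qed (use True P in \<open>auto simp: rough_def\<close>)
      hence "(\<Sum>g | g \<in> rough m n \<and> P \<in># g. \<nu> g P) = (\<Sum>g\<in>rough m (n - d P). \<nu> (add_mset P g) P)"
        by (simp add: sum.reindex inj_on_def)
      also have "\<dots> = c P (n - d P) + s * W (n - d P)"
        by (simp add: \<nu>_add c_def W_def sum.distrib sum_distrib_left)
      finally show ?thesis using True by simp
    next
      case False
      hence "{g \<in> rough m n. P \<in># g} = {}" by (auto simp: rough_def dest: le_deg)
      thus ?thesis using False by (simp only: sum.empty if_False)
    qed
    finally show ?thesis .
  qed
  have c_eq: "c P n = (\<Sum>k | k \<in> {1..n} \<and> d P dvd k. s * W (n - k))" if "m < d P" for P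
    by (rule sum_dvd_recursion[OF d_pos c_rec[OF that]])
  have fin: "finite {P. m < d P \<and> d P \<le> n}" using finite_primes[of n] by simp
  have "real n * W n = (\<Sum>g\<in>rough m n. real (deg d g) * \<omega> g)"
    unfolding W_def sum_distrib_left by (intro sum.cong) (auto simp: rough_def)
  also have "\<dots> = (\<Sum>g\<in>rough m n. \<Sum>P\<in>{P. m < d P \<and> d P \<le> n}. real (d P) * \<nu> g P)"
    unfolding deg
  proof (rule sum.cong[OF refl])
    fix g assume "g \<in> rough m n"
    hence "set_mset g \<subseteq> {P. m < d P \<and> d P \<le> n}" by (auto simp: rough_def dest: le_deg)
    thus "(\<Sum>P\<in>set_mset g. real (d P) * \<nu> g P) = (\<Sum>P | m < d P \<and> d P \<le> n. real (d P) * \<nu> g P)"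
      using fin by (intro sum.mono_neutral_left) (auto simp: \<nu>0)
  qed
  also have "\<dots> = (\<Sum>P\<in>{P. m < d P \<and> d P \<le> n}. real (d P) * c P n)"
    by (subst sum.swap) (simp add: c_def sum_distrib_left)
  also have "\<dots> = (\<Sum>P\<in>{P. m < d P \<and> d P \<le> n}. \<Sum>k | k \<in> {1..n} \<and> d P dvd k. real (d P) * (s * W (n - k)))"
    by (intro sum.cong) (auto simp: c_eq sum_distrib_left)
  \<comment> \<open>For each \<open>k\<close> the primes with \<open>d P dvd k\<close> are
    collected; their degrees add up to \<open>wt m k\<close>.\<close>
  also have "\<dots> = (\<Sum>k=1..n. \<Sum>P | P \<in> {P. m < d P \<and> d P \<le> n} \<and> d P dvd k. real (d P) * (s * W (n - k)))"
    by (rule sum.swap_restrict) (use fin in auto)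
  also have "\<dots> = (\<Sum>k=1..n. s * (wt m k * W (n - k)))"
  proof (intro sum.cong refl)
    fix k assume k: "k \<in> {1..n}"
    have "{P. P \<in> {P. m < d P \<and> d P \<le> n} \<and> d P dvd k} = {P. m < d P \<and> d P dvd k}"
      using k by (auto dest: dvd_imp_le)
    thus "(\<Sum>P | P \<in> {P. m < d P \<and> d P \<le> n} \<and> d P dvd k. real (d P) * (s * W (n - k))) =
        s * (wt m k * W (n - k))"
      by (simp add: wt_def sum_distrib_right sum_distrib_left mult_ac)
  qed
  finally show ?thesis by (simp add: W_def sum_distrib_left)
qed

lemma Gsharp_recursion:
  "real n * real (Gsharp d n) = (\<Sum>k=1..n. wt 0 k * real (Gsharp d (n - k)))"
proof -
  have eq: "rough 0 n = {g. deg d g = n}" for n using d_pos by (auto simp: rough_def)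
  have "real n * (\<Sum>g\<in>rough 0 n. 1) = 1 * (\<Sum>k=1..n. wt 0 k * (\<Sum>g\<in>rough 0 (n - k). 1))"
  proof (rule weighted_degree_recursion)
    show "real (deg d g) * 1 = (\<Sum>P\<in>set_mset g. real (d P) * real (count g P))" for g
      by (simp add: deg_eq_sum_count)
  qed (auto simp: not_in_iff)
  thus ?thesis by (simp add: eq Gsharp_def)
qed

definition A :: "nat \<Rightarrow> nat \<Rightarrow> real" where
  "A m n = (\<Sum>g\<in>rough m n. real_of_int (moebius g))"

definition M :: "nat \<Rightarrow> nat \<Rightarrow> real" where
  "M m x = (\<Sum>n\<le>x. A m n / q ^ n)"

lemma A_recursion: "real n * A m n = - (\<Sum>k=1..n. wt m k * A m (n - k))"
proof -
  have "real n * (\<Sum>g\<in>rough m n. real_of_int (moebius g)) =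
     (-1) * (\<Sum>k=1..n. wt m k * (\<Sum>g\<in>rough m (n - k). real_of_int (moebius g)))"
  proof (rule weighted_degree_recursion)
    show "real (deg d g) * real_of_int (moebius g) =
        (\<Sum>P\<in>set_mset g. real (d P) * (if P \<in># g then real_of_int (moebius g) else 0))" for g
    \<comment> \<open>For squarefree \<open>g\<close> the degree is the sum of the degrees of its
      distinct primes; otherwise both sides vanish.\<close>
    proof (cases "\<forall>P. count g P \<le> 1")
      case True
      hence "count g P = 1" if "P \<in># g" for P
        using that by (metis count_greater_eq_one_iff le_antisym)
      thus ?thesis by (simp add: deg_eq_sum_count sum_distrib_right)
    qed (auto simp: moebius_def)
  qed (auto simp: moebius_add_mset)
  thus ?thesis by (simp add: A_def)
qed

text \<open>Partial summation divides the generating function by 1 - w, which adds 1 to each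
  coefficient of its logarithmic derivative. This replaces \<open>- wt m k / q ^ k\<close>, which is
  not small, by \<open>1 - wt m k / q ^ k\<close>.\<close>

lemma M_recursion: "real x * M m x = (\<Sum>k=1..x. (1 - wt m k / q ^ k) * M m (x - k))"
proof (induction x)
  case (Suc x)
  define a where "a = (\<lambda>n. A m n / q ^ n)"
  define b where "b = (\<lambda>k. 1 - wt m k / q ^ k)"
  have M_Suc: "M m (Suc y) = M m y + a (Suc y)" for y by (simp add: M_def a_def)
  have M_sum: "M m y = (\<Sum>n\<le>y. a n)" for y by (simp add: M_def a_def)
  have a_rec: "real n * a n = - (\<Sum>k=1..n. wt m k / q ^ k * a (n - k))" for n
  proof -
    have "real n * a n = (real n * A m n) / q ^ n" by (simp add: a_def)
    also have "\<dots> = - (\<Sum>k=1..n. wt m k * A m (n - k) / q ^ n)"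
      unfolding A_recursion by (simp add: sum_divide_distrib)
    also have "(\<Sum>k=1..n. wt m k * A m (n - k) / q ^ n) = (\<Sum>k=1..n. wt m k / q ^ k * a (n - k))"
    proof (intro sum.cong refl)
      fix k assume "k \<in> {1..n}"
      hence "q ^ n = q ^ k * q ^ (n - k)" by (simp flip: power_add)
      thus "wt m k * A m (n - k) / q ^ n = wt m k / q ^ k * a (n - k)" by (simp add: a_def)
    qed
    finally show ?thesis .
  qed
  \<comment> \<open>Splitting off the last summand of each \<open>M\<close> leaves the induction
    hypothesis \<open>x * M m x\<close> and a sum that evaluates to
    \<open>M m x + Suc x * a (Suc x)\<close>. Together they give
    \<open>Suc x * M m (Suc x)\<close>.\<close>
  have "(\<Sum>k=1..Suc x. b k * M m (Suc x - k)) =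
      (\<Sum>k=1..x. b k * M m (x - k)) + (\<Sum>k=1..Suc x. b k * a (Suc x - k))"
  proof -
    have "(\<Sum>k=1..x. b k * M m (Suc x - k)) = (\<Sum>k=1..x. b k * M m (x - k) + b k * a (Suc x - k))"
      by (intro sum.cong refl) (auto simp: Suc_diff_le M_Suc algebra_simps)
    thus ?thesis by (simp add: sum.distrib M_sum)
  qed
  also have "(\<Sum>k=1..Suc x. b k * a (Suc x - k)) = (\<Sum>k=1..Suc x. a (Suc x - k)) + real (Suc x) * a (Suc x)"
    unfolding a_rec b_def by (simp add: left_diff_distrib sum_subtractf)
  also have "(\<Sum>k=1..Suc x. a (Suc x - k)) = M m x"
    unfolding M_sum
    by (rule sum.reindex_bij_witness[of _ "\<lambda>i. Suc x - i" "\<lambda>k. Suc x - k"]) auto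
  also have "(\<Sum>k=1..x. b k * M m (x - k)) = real x * M m x" using Suc by (simp add: b_def)
  finally show ?case by (simp add: b_def M_Suc algebra_simps)
qed auto

lemma M_0 [simp]: "M m 0 = 1"
proof -
  have "rough m 0 = {{#}}" by (auto simp: rough_def)
  thus ?thesis by (simp add: M_def A_def)
qed

lemma wt_eq_0: "0 < k \<Longrightarrow> k \<le> m \<Longrightarrow> wt m k = 0"
proof -
  assume "0 < k" "k \<le> m"
  hence "{P. m < d P \<and> d P dvd k} = {}" by (auto dest!: dvd_imp_le)
  thus ?thesis by (simp only: wt_def sum.empty)
qed

lemma wt_nonneg: "wt m k \<ge> 0"
  by (simp add: wt_def sum_nonneg)

lemma card_primes_le_wt:
  assumes "n > 0"
  shows "real n * real (card {P. d P = n}) \<le> wt 0 n"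
proof -
  have "real n * real (card {P. d P = n}) = (\<Sum>P | d P = n. real (d P))" by simp
  also have "\<dots> \<le> wt 0 n"
    unfolding wt_def using assms finite_dvd_primes[of n 0] by (intro sum_mono2) auto
  finally show ?thesis .
qed

end

section \<open>Toeplitz and dominated limits; bounds for rough Moebius sums\<close>

text \<open>Tannery's theorem for sums whose length grows with \<open>n\<close>: extending the
  summand by 0 turns them into infinite series.\<close>

lemma sum_tendsto_0_dominated:
  fixes f :: "nat \<Rightarrow> nat \<Rightarrow> 'a :: {real_normed_algebra, banach}"
  assumes lim: "\<And>k. (\<lambda>n. f k n) \<longlonglongrightarrow> 0"
    and bound: "\<And>k n. 1 \<le> k \<Longrightarrow> k \<le> n \<Longrightarrow> norm (f k n) \<le> N k"
    and N: "summable N"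
  shows "(\<lambda>n. \<Sum>k=1..n. f k n) \<longlonglongrightarrow> 0"
proof -
  define F where "F = (\<lambda>k n. if 1 \<le> k \<and> k \<le> n then f k n else 0)"
  have "(\<lambda>n. suminf (\<lambda>k. F k n)) \<longlonglongrightarrow> (\<Sum>k. 0)"
  proof (rule conjunct2[OF conjunct2[OF tannerys_theorem[OF _ _ N]]])
    show "(\<lambda>n. F k n) \<longlonglongrightarrow> 0" for k
    proof (rule tendsto_norm_zero_cancel, rule tendsto_sandwich[OF _ _ tendsto_const])
      show "(\<lambda>n. norm (f k n)) \<longlonglongrightarrow> 0" using lim[of k] by (rule tendsto_norm_zero)
    qed (auto simp: F_def)
    \<comment> \<open>No sign is known for \<open>N 0\<close>, so the domination starts at
      \<open>k = 1\<close>. For \<open>k > n\<close> it needs \<open>N k \<ge> 0\<close>, which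
      follows from the bound at \<open>n = k\<close>.\<close>
    have "norm (F k n) \<le> N k" if "1 \<le> k" for k n
      using bound[OF that] order_trans[OF norm_ge_zero bound[of k k]] that by (auto simp: F_def)
    thus "\<forall>\<^sub>F (k, n) in sequentially \<times>\<^sub>F sequentially. norm (F k n) \<le> N k"
      unfolding eventually_prod_sequentially by auto
  qed auto
  moreover have "suminf (\<lambda>k. F k n) = (\<Sum>k=1..n. f k n)" for n
    by (subst suminf_finite[of "{1..n}"]) (auto simp: F_def)
  ultimately show ?thesis by simp
qed

text \<open>After subtracting \<open>L\<close>, the terms up to a fixed \<open>K\<close> vanish in
  the limit because each weight does. The tail is at most \<open>e'\<close> times the total
  mass.\<close>

lemma toeplitz_weighted_limit:
  fixes w :: "nat \<Rightarrow> nat \<Rightarrow> real"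
  assumes bound: "\<And>n. (\<Sum>k=1..n. \<bar>w k n\<bar>) \<le> W"
    and null: "\<And>k. (\<lambda>n. w k n) \<longlonglongrightarrow> 0"
    and total: "(\<lambda>n. \<Sum>k=1..n. w k n) \<longlonglongrightarrow> 1"
    and s: "s \<longlonglongrightarrow> L"
  shows "(\<lambda>n. \<Sum>k=1..n. s k * w k n) \<longlonglongrightarrow> L"
proof -
  have W: "W \<ge> 0" using bound[of 0] by simp
  have "(\<lambda>n. \<Sum>k=1..n. (s k - L) * w k n) \<longlonglongrightarrow> 0"
  proof (rule LIMSEQ_I)
    fix e :: real assume e: "e > 0"
    \<comment> \<open>The summand 1 keeps the denominator positive when \<open>W = 0\<close> and
      makes \<open>e' * W < e / 2\<close> strict.\<close>
    define e' where "e' = e / (2 * (W + 1))"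
    have e': "e' > 0" using e W by (simp add: e'_def)
    obtain K where K: "\<And>k. k \<ge> K \<Longrightarrow> \<bar>s k - L\<bar> < e'"
      using LIMSEQ_D[OF s e'] by auto
    have "(\<lambda>n. \<Sum>k=1..K. (s k - L) * w k n) \<longlonglongrightarrow> (\<Sum>k=1..K. (s k - L) * 0)"
      by (intro tendsto_sum tendsto_mult tendsto_const null)
    hence "(\<lambda>n. \<Sum>k=1..K. (s k - L) * w k n) \<longlonglongrightarrow> 0" by simp
    from LIMSEQ_D[OF this half_gt_zero[OF e]] obtain n0 where
      n0: "\<And>n. n \<ge> n0 \<Longrightarrow> \<bar>\<Sum>k=1..K. (s k - L) * w k n\<bar> < e / 2" by auto
    have "norm ((\<Sum>k=1..n. (s k - L) * w k n) - 0) < e" if n: "n \<ge> max n0 K" for n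
    proof -
      have split: "{1..n} = {1..K} \<union> {Suc K..n}" using n by auto
      have "(\<Sum>k=1..n. (s k - L) * w k n) =
          (\<Sum>k=1..K. (s k - L) * w k n) + (\<Sum>k=Suc K..n. (s k - L) * w k n)"
        unfolding split by (rule sum.union_disjoint) auto
      moreover have "\<bar>\<Sum>k=Suc K..n. (s k - L) * w k n\<bar> \<le> (\<Sum>k=Suc K..n. e' * \<bar>w k n\<bar>)"
      proof (rule sum_norm_le[where 'a = real, unfolded real_norm_def])
        fix k assume "k \<in> {Suc K..n}"
        hence "\<bar>s k - L\<bar> \<le> e'" using K[of k] by simp
        thus "\<bar>(s k - L) * w k n\<bar> \<le> e' * \<bar>w k n\<bar>" by (simp add: abs_mult mult_right_mono)
      qed
      moreover have "(\<Sum>k=Suc K..n. e' * \<bar>w k n\<bar>) \<le> (\<Sum>k=1..n. e' * \<bar>w k n\<bar>)"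
        using e' by (intro sum_mono2) auto
      moreover have "(\<Sum>k=1..n. e' * \<bar>w k n\<bar>) \<le> e' * W"
        using bound[of n] e' by (simp add: mult_left_mono flip: sum_distrib_left)
      moreover have "e' * W < e / 2"
        using e W by (simp add: e'_def field_simps)
      ultimately show ?thesis using n0[of n] n by simp
    qed
    thus "\<exists>no. \<forall>n\<ge>no. norm ((\<Sum>k=1..n. (s k - L) * w k n) - 0) < e" by blast
  qed
  from tendsto_add[OF this tendsto_mult[OF tendsto_const[of L] total]]
  show ?thesis
    by (simp add: left_diff_distrib sum_subtractf sum_distrib_left)
qed

lemma sum_Pow_power_card:
  fixes t :: real
  assumes "finite X"
  shows "(\<Sum>J\<in>Pow X. t ^ card J) = (1 + t) ^ card X"
proof -
  have "(\<Sum>J\<in>Pow X. t ^ card J) = (\<Sum>J\<in>Pow X. (\<Prod>_\<in>J. t) * (\<Prod>_\<in>X - J. 1))" by simp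
  also have "\<dots> = (\<Prod>_\<in>X. t + 1)" using assms by (simp only: prod_add)
  finally show ?thesis by (simp add: add.commute)
qed

section \<open>Uniform bounds for rough Moebius sums from the prime element theorem\<close>

locale pnt_semigroup = degree_semigroup d q for d :: "'p \<Rightarrow> nat" and q :: real +
  assumes pnt: "summable (\<lambda>k. \<bar>1 - wt 0 (Suc k) / q ^ Suc k\<bar>)"
begin

text \<open>The part of \<Lambda>(k) that comes from primes of degree a proper divisor of
  \<open>k\<close>. It bounds the loss in passing from \<open>wt 0 k\<close> to
  \<open>wt m k\<close>, uniformly in \<open>m < k\<close>.\<close>

definition small_wt :: "nat \<Rightarrow> real" where
  "small_wt k = (\<Sum>P | d P < k \<and> d P dvd k. real (d P))"

definition R :: "nat \<Rightarrow> real" where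
  "R k = \<bar>1 - wt 0 k / q ^ k\<bar> + small_wt k / q ^ k"

definition \<phi> :: "nat \<Rightarrow> real" where
  "\<phi> m = real (card {P. d P = m}) / q ^ m"

lemma wt_le: "\<exists>C>0. \<forall>k>0. wt 0 k \<le> C * q ^ k"
proof -
  define C where "C = 1 + (\<Sum>k. \<bar>1 - wt 0 (Suc k) / q ^ Suc k\<bar>)"
  have "wt 0 k \<le> C * q ^ k" if k: "k > 0" for k
  proof -
    obtain j where j: "k = Suc j" using k by (cases k) auto
    have "(\<Sum>k\<in>{j}. \<bar>1 - wt 0 (Suc k) / q ^ Suc k\<bar>) \<le> (\<Sum>k. \<bar>1 - wt 0 (Suc k) / q ^ Suc k\<bar>)"
      by (intro sum_le_suminf pnt) auto
    hence "wt 0 k / q ^ k \<le> C" unfolding C_def j by simp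
    thus ?thesis using q_pos by (simp add: field_simps)
  qed
  moreover have "C > 0" unfolding C_def by (intro add_pos_nonneg suminf_nonneg pnt) auto
  ultimately show ?thesis by blast
qed

text \<open>A proper divisor of \<open>k\<close> is at most \<open>k div 2\<close>, and the primes
  of degree \<open>j\<close> contribute at most \<open>wt 0 j\<close>.\<close>

lemma small_wt_le: "small_wt k \<le> (\<Sum>j=1..k div 2. wt 0 j)"
proof -
  have "{P. d P < k \<and> d P dvd k} \<subseteq> (\<Union>j\<in>{1..k div 2}. {P. d P = j})"
  proof clarify
    fix P assume P: "d P < k" "d P dvd k"
    then obtain c where c: "k = d P * c" by blast
    hence "c \<noteq> 0" "c \<noteq> 1" using P by auto
    hence "d P * 2 \<le> d P * c" by (intro mult_le_mono2) auto
    hence "d P \<in> {1..k div 2}" using d_pos[of P] unfolding c[symmetric] by simp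
    thus "P \<in> (\<Union>j\<in>{1..k div 2}. {P. d P = j})" by auto
  qed
  hence "small_wt k \<le> (\<Sum>P\<in>(\<Union>j\<in>{1..k div 2}. {P. d P = j}). real (d P))"
    unfolding small_wt_def by (intro sum_mono2) auto
  also have "\<dots> = (\<Sum>j=1..k div 2. \<Sum>P | d P = j. real (d P))"
    by (rule sum.UNION_disjoint) auto
  also have "\<dots> \<le> (\<Sum>j=1..k div 2. wt 0 j)"
    using card_primes_le_wt by (intro sum_mono) (auto simp: mult_ac)
  finally show ?thesis .
qed

lemma small_wt_nonneg: "small_wt k \<ge> 0"
  by (simp add: small_wt_def sum_nonneg)

lemma R_nonneg: "R k \<ge> 0"
  using small_wt_nonneg[of k] q_pos by (simp add: R_def)

text \<open>By \<open>small_wt_le\<close> and the bound \<open>wt_le\<close>,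
  \<open>small_wt k\<close> is O(q^(k/2)), so its quotient by \<open>q ^ k\<close> decays
  geometrically. Powers of \<open>sqrt q\<close> treat both parities of \<open>k\<close> at
  once.\<close>

lemma summable_R: "summable R"
proof -
  obtain C where C: "C > 0" "\<And>k. k > 0 \<Longrightarrow> wt 0 k \<le> C * q ^ k" using wt_le by blast
  have sq: "sqrt q > 1" "sqrt q ^ 2 = q" using q_gt_1 by auto
  have "summable (\<lambda>k. small_wt k / q ^ k)"
  proof (rule summable_comparison_test')
    show "summable (\<lambda>k. C * (q / (q - 1)) * (1 / sqrt q) ^ k)"
      using sq by (intro summable_mult summable_geometric) auto
    show "norm (small_wt k / q ^ k) \<le> C * (q / (q - 1)) * (1 / sqrt q) ^ k" if "k \<ge> 0" for k
    proof -
      have "small_wt k \<le> (\<Sum>j=1..k div 2. C * q ^ j)"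
        by (rule order_trans[OF small_wt_le sum_mono]) (auto intro: C)
      also have "\<dots> \<le> (\<Sum>j<Suc (k div 2). C * q ^ j)"
        using C(1) q_pos by (intro sum_mono2) auto
      also have "\<dots> = C * ((q ^ Suc (k div 2) - 1) / (q - 1))"
        using q_gt_1 by (simp add: geometric_sum flip: sum_distrib_left del: sum.lessThan_Suc power_Suc)
      also have "\<dots> \<le> C * (q ^ Suc (k div 2) / (q - 1))"
        using C(1) q_gt_1 by (intro mult_left_mono divide_right_mono) auto
      also have "\<dots> = C * (q / (q - 1)) * q ^ (k div 2)" by simp
      also have "q ^ (k div 2) = sqrt q ^ (2 * (k div 2))" by (simp only: power_mult sq)
      also have "\<dots> \<le> sqrt q ^ k" using sq by (intro power_increasing) auto
      finally have le: "small_wt k \<le> C * (q / (q - 1)) * sqrt q ^ k"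
        using C(1) q_gt_1 by (simp add: mult_left_mono divide_right_mono)
      have sq_pow: "q ^ k = sqrt q ^ k * sqrt q ^ k"
        using q_pos by (simp flip: power_mult_distrib)
      have "small_wt k / q ^ k \<le> C * (q / (q - 1)) * sqrt q ^ k / (sqrt q ^ k * sqrt q ^ k)"
        unfolding sq_pow using q_pos by (intro divide_right_mono le) auto
      also have "\<dots> = C * (q / (q - 1)) * (1 / sqrt q) ^ k"
        using q_pos by (simp add: power_divide)
      finally show ?thesis using small_wt_nonneg[of k] q_pos by simp
    qed
  qed
  moreover have "summable (\<lambda>k. \<bar>1 - wt 0 k / q ^ k\<bar>)"
    using pnt by (subst (asm) summable_Suc_iff)
  ultimately show ?thesis unfolding R_def by (intro summable_add)
qed

text \<open>The primes missing from \<open>wt m k\<close> have degree at most \<open>m < k\<close>,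
  so they are among those counted in \<open>small_wt k\<close>.\<close>

lemma wt_diff_le:
  assumes "m < k"
  shows "\<bar>1 - wt m k / q ^ k\<bar> \<le> R k"
proof -
  have k: "k > 0" using assms by simp
  have fin: "finite {P. d P \<le> m \<and> d P dvd k}"
    using finite_primes[of m] by (rule rev_finite_subset) auto
  have "{P. 0 < d P \<and> d P dvd k} = {P. m < d P \<and> d P dvd k} \<union> {P. d P \<le> m \<and> d P dvd k}"
    using d_pos by auto
  hence "wt 0 k = wt m k + (\<Sum>P | d P \<le> m \<and> d P dvd k. real (d P))"
    unfolding wt_def using fin finite_dvd_primes[OF k, of m]
    by (simp only:) (rule sum.union_disjoint, auto)
  moreover have "(\<Sum>P | d P \<le> m \<and> d P dvd k. real (d P)) \<le> small_wt k"
    unfolding small_wt_def using assms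
    by (intro sum_mono2 finite_subset[OF _ finite_primes[of k]]) auto
  moreover have "(\<Sum>P | d P \<le> m \<and> d P dvd k. real (d P)) \<ge> 0" by (simp add: sum_nonneg)
  ultimately have "\<bar>wt 0 k - wt m k\<bar> \<le> small_wt k" by simp
  hence "\<bar>wt 0 k - wt m k\<bar> / q ^ k \<le> small_wt k / q ^ k" using q_pos by (simp add: divide_right_mono)
  moreover have "\<bar>wt 0 k - wt m k\<bar> / q ^ k = \<bar>wt 0 k / q ^ k - wt m k / q ^ k\<bar>"
    using q_pos by (simp add: abs_divide flip: diff_divide_distrib)
  ultimately show ?thesis unfolding R_def by linarith
qed

text \<open>Only values of \<open>M\<close> below \<open>x\<close> must be bounded by
  \<open>b\<close>. The estimate thus serves as an induction step for boundedness and, once a global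
  bound is known, as a source of decay.\<close>

lemma M_step:
  assumes b: "\<And>y. y < x \<Longrightarrow> \<bar>M m y\<bar> \<le> b"
  shows "real x * \<bar>M m x\<bar> \<le> b * (\<Sum>k=1..x. if k \<le> m then 1 else R k)"
proof -
  have "real x * \<bar>M m x\<bar> = \<bar>\<Sum>k=1..x. (1 - wt m k / q ^ k) * M m (x - k)\<bar>"
    unfolding M_recursion[symmetric] by (simp add: abs_mult)
  also have "\<dots> \<le> (\<Sum>k=1..x. (if k \<le> m then 1 else R k) * b)"
  proof (rule sum_norm_le[where 'a = real, unfolded real_norm_def])
    fix k assume k: "k \<in> {1..x}"
    have "\<bar>1 - wt m k / q ^ k\<bar> \<le> (if k \<le> m then 1 else R k)"
      using k wt_eq_0[of k m] wt_diff_le[of m k] by auto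
    moreover have "\<bar>M m (x - k)\<bar> \<le> b" using k by (intro b) auto
    ultimately show "\<bar>(1 - wt m k / q ^ k) * M m (x - k)\<bar> \<le> (if k \<le> m then 1 else R k) * b"
      unfolding abs_mult using R_nonneg by (intro mult_mono) auto
  qed
  finally show ?thesis by (simp add: sum_distrib_left mult_ac)
qed

lemma step_sum_le: "(\<Sum>k=1..x. if k \<le> m then 1 else R k) \<le> real m + suminf R"
proof -
  have "(\<Sum>k=1..x. if k \<le> m then 1 else R k) \<le> (\<Sum>k\<in>{1..x}. (if k \<in> {1..m} then 1 else 0) + R k)"
    using R_nonneg by (intro sum_mono) auto
  also have "\<dots> = real (card ({1..x} \<inter> {1..m})) + (\<Sum>k\<in>{1..x}. R k)"
    by (subst sum.distrib) (simp add: sum.If_cases Int_def conj_ac)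
  also have "\<dots> \<le> real m + suminf R"
  proof (intro add_mono sum_le_suminf summable_R)
    have "card ({1..x} \<inter> {1..m}) \<le> card {1..m}" by (intro card_mono) auto
    thus "real (card ({1..x} \<inter> {1..m})) \<le> real m" by simp
  qed (auto simp: R_nonneg)
  finally show ?thesis .
qed

text \<open>For \<open>x > m\<close> the first \<open>m\<close> terms contribute \<open>m\<close>,
  the tail at most 1, and \<open>m + 1 \<le> x\<close>.\<close>

lemma step_sum_le_arg:
  assumes "\<And>n. n > m \<Longrightarrow> (\<Sum>k=Suc m..n. R k) \<le> 1"
  shows "(\<Sum>k=1..x. if k \<le> m then 1 else R k) \<le> real x"
proof (cases "x \<le> m")
  case True
  hence "(\<Sum>k=1..x. if k \<le> m then 1 else R k) = (\<Sum>k=1..x. 1)" by (intro sum.cong) auto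
  thus ?thesis by simp
next
  case False
  hence split: "{1..x} = {1..m} \<union> {Suc m..x}" by auto
  have "(\<Sum>k=1..x. if k \<le> m then 1 else R k) =
      (\<Sum>k=1..m. if k \<le> m then 1 else R k) + (\<Sum>k=Suc m..x. if k \<le> m then 1 else R k)"
    unfolding split by (rule sum.union_disjoint) auto
  also have "\<dots> = real m + (\<Sum>k=Suc m..x. R k)"
    by (intro arg_cong2[where f = "(+)"]) (auto intro!: sum.cong)
  finally show ?thesis using assms[of x] False by simp
qed

text \<open>For large \<open>m\<close> the coefficients of the recursion for \<open>x M(m, x)\<close> have total mass at most \<open>x\<close>, so
  \<open>|M| \<le> 1\<close>; for the finitely many remaining \<open>m\<close> the mass is at most \<open>x\<close> once \<open>x \<ge> m + \<Sum>R\<close>.\<close>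
lemma M_bounded: "\<exists>B>0. \<forall>m x. \<bar>M m x\<bar> \<le> B"
proof -
  obtain m0 where m0: "\<And>m n. m \<ge> m0 \<Longrightarrow> norm (sum R {m..n}) < 1"
    using summable_partial_sum_bound[OF summable_R zero_less_one] by blast
  \<comment> \<open>For \<open>m \<le> m0\<close> and \<open>x > X\<close> the mass bound
    \<open>m + suminf R\<close> is at most \<open>x\<close>. The remaining finite rectangle is
    absorbed into the maximum \<open>B\<close>.\<close>
  define X where "X = nat \<lceil>real m0 + suminf R\<rceil>"
  define B where "B = Max (insert 1 ((\<lambda>(m, x). \<bar>M m x\<bar>) ` ({..m0} \<times> {..X})))"
  have B1: "B \<ge> 1" unfolding B_def by (intro Max_ge) auto
  have "\<bar>M m x\<bar> \<le> B" for m x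
  proof (induction x rule: less_induct)
    case (less x)
    show ?case
    proof (cases "m \<le> m0 \<and> x \<le> X")
      case True
      thus ?thesis unfolding B_def by (intro Max_ge) auto
    next
      case nle: False
      show ?thesis
      proof (cases "x = 0")
        case False
        have "(\<Sum>k=1..x. if k \<le> m then 1 else R k) \<le> real x"
        proof (cases "m \<le> m0")
          case True
          have "real m + suminf R \<le> real x"
            using True nle unfolding X_def by linarith
          thus ?thesis using step_sum_le[where x = x and m = m] by linarith
        next
          case False
          show ?thesis
          proof (rule step_sum_le_arg)
            show "sum R {Suc m..n} \<le> 1" for n using m0[of "Suc m" n] False by simp
          qed
        qed
        hence "B * (\<Sum>k=1..x. if k \<le> m then 1 else R k) \<le> B * real x"
          using B1 by (intro mult_left_mono) auto
        moreover have "real x * \<bar>M m x\<bar> \<le> B * (\<Sum>k=1..x. if k \<le> m then 1 else R k)"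
          by (rule M_step) (rule less.IH)
        ultimately have "real x * \<bar>M m x\<bar> \<le> real x * B" by (simp add: mult_ac)
        thus ?thesis using False by simp
      qed (use B1 in auto)
    qed
  qed
  thus ?thesis using B1 by (intro exI[of _ B]) auto
qed

text \<open>The uniform bound is fed back into the recursion, whose coefficients have total mass at
  most \<open>m + suminf R\<close>.\<close>

lemma M_decay: "\<exists>D>0. \<forall>m x. real x * \<bar>M m x\<bar> \<le> D * (real m + 1)"
proof -
  obtain B where B: "B > 0" "\<And>m x. \<bar>M m x\<bar> \<le> B" using M_bounded by blast
  have Rs: "suminf R \<ge> 0" by (intro suminf_nonneg summable_R R_nonneg)
  have "real x * \<bar>M m x\<bar> \<le> B * (1 + suminf R) * (real m + 1)" for m x
  proof -
    have "real x * \<bar>M m x\<bar> \<le> B * (\<Sum>k=1..x. if k \<le> m then 1 else R k)"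
      by (rule M_step) (rule B)
    also have "\<dots> \<le> B * (real m + suminf R)"
      using B(1) by (intro mult_left_mono step_sum_le) auto
    also have "\<dots> \<le> B * ((1 + suminf R) * (real m + 1))"
      using B(1) Rs by (intro mult_left_mono) (auto simp: algebra_simps)
    finally show ?thesis by (simp add: mult_ac)
  qed
  thus ?thesis using B(1) Rs by (intro exI[of _ "B * (1 + suminf R)"]) auto
qed

lemma M_tendsto_0: "M m \<longlonglongrightarrow> 0"
proof -
  obtain D where D: "\<And>m x. real x * \<bar>M m x\<bar> \<le> D * (real m + 1)" using M_decay by blast
  have "(\<lambda>x. D * (real m + 1) / real x) \<longlonglongrightarrow> 0" by (rule lim_const_over_n)
  moreover have "\<forall>\<^sub>F x in sequentially. norm (M m x) \<le> D * (real m + 1) / real x"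
    using eventually_gt_at_top[of 0]
  proof eventually_elim
    case (elim x)
    thus ?case using D[of x m] by (simp add: field_simps)
  qed
  ultimately show ?thesis by (rule Lim_null_comparison[rotated])
qed

lemma \<phi>_nonneg: "\<phi> m \<ge> 0"
  using q_pos by (simp add: \<phi>_def)

lemma \<phi>_le: "\<exists>C>0. \<forall>m>0. \<phi> m \<le> C / real m"
proof -
  obtain C where C: "C > 0" "\<And>k. k > 0 \<Longrightarrow> wt 0 k \<le> C * q ^ k" using wt_le by blast
  have "\<phi> m \<le> C / real m" if "m > 0" for m
  proof -
    have "real m * real (card {P. d P = m}) \<le> C * q ^ m"
      using card_primes_le_wt[OF that] C(2)[OF that] by linarith
    thus ?thesis using that q_pos by (simp add: \<phi>_def field_simps)
  qed
  thus ?thesis using C(1) by blast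
qed

text \<open>Each of the \<open>n\<close> terms is O(1/n). For \<open>l > n/2\<close> this holds
  because \<open>\<phi> l\<close> is O(1/l) and \<open>M\<close> is bounded; for
  \<open>l \<le> n/2\<close> the argument \<open>n - l\<close> is at least n/2, and the decay O((l +
  1)/n) of \<open>M\<close> cancels the 1/l.\<close>

lemma weighted_M_bounded: "\<exists>W>0. \<forall>n. (\<Sum>l=1..n. \<phi> l * \<bar>M l (n - l)\<bar>) \<le> W"
proof -
  obtain B where B: "B > 0" "\<And>m x. \<bar>M m x\<bar> \<le> B" using M_bounded by blast
  obtain D where D: "D > 0" "\<And>m x. real x * \<bar>M m x\<bar> \<le> D * (real m + 1)" using M_decay by blast
  obtain C where C: "C > 0" "\<And>m. m > 0 \<Longrightarrow> \<phi> m \<le> C / real m" using \<phi>_le by blast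
  \<comment> \<open>The two summands belong to the ranges \<open>2 * l > n\<close> and
    \<open>2 * l \<le> n\<close>; in the latter \<open>n \<le> 2 * (n - l)\<close> and
    \<open>l + 1 \<le> 2 * l\<close> each give a factor 2.\<close>
  define W where "W = 2 * C * B + 4 * C * D"
  have "(\<Sum>l=1..n. \<phi> l * \<bar>M l (n - l)\<bar>) \<le> W" for n
  proof (cases "n = 0")
    case False
    have "(\<Sum>l=1..n. \<phi> l * \<bar>M l (n - l)\<bar>) \<le> (\<Sum>l=1..n. W / real n)"
    proof (rule sum_mono)
      fix l assume l: "l \<in> {1..n}"
      have "\<phi> l * \<bar>M l (n - l)\<bar> \<le> C / real l * \<bar>M l (n - l)\<bar>"
        using l by (intro mult_right_mono C) auto
      also have "\<dots> \<le> W / real n"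
      proof (cases "2 * l > n")
        case True
        have "C / real l * \<bar>M l (n - l)\<bar> \<le> C / real l * B"
          using C(1) by (intro mult_left_mono B) auto
        also have "\<dots> \<le> (2 * C * B) / real n"
          using True l C(1) B(1) by (simp add: field_simps)
        also have "\<dots> \<le> W / real n"
          using C(1) D(1) by (intro divide_right_mono) (auto simp: W_def)
        finally show ?thesis .
      next
        case False
        define y where "y = \<bar>M l (n - l)\<bar>"
        have y: "y \<ge> 0" by (simp add: y_def)
        have "real n * y \<le> 2 * real (n - l) * y"
          using False y l by (intro mult_right_mono) auto
        also have "\<dots> \<le> 2 * (D * (real l + 1))" using D(2)[of "n - l" l] by (simp add: y_def)
        also have "\<dots> \<le> 4 * D * real l" using D(1) l by simp
        finally have "C * (real n * y) \<le> C * (4 * D * real l)"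
          using C(1) by (intro mult_left_mono) auto
        hence "C / real l * y \<le> (4 * C * D) / real n"
          using l by (simp add: field_simps)
        also have "\<dots> \<le> W / real n"
          using C(1) B(1) by (intro divide_right_mono) (auto simp: W_def)
        finally show ?thesis by (simp add: y_def)
      qed
      finally show "\<phi> l * \<bar>M l (n - l)\<bar> \<le> W / real n" .
    qed
    also have "\<dots> = W" using False by simp
    finally show ?thesis .
  qed (use B C D in \<open>auto simp: W_def\<close>)
  moreover have "W > 0" using B C D by (auto simp: W_def intro!: add_pos_pos)
  ultimately show ?thesis by blast
qed

end

section \<open>Sorting by the minimal prime\<close>

context degree_semigroup
begin

lemma deg_pos_iff: "0 < deg d g \<longleftrightarrow> g \<noteq> {#}"
  using deg_eq_0_iff[of g] by linarith

definition wmu :: "'p multiset \<Rightarrow> real" where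
  "wmu g = real_of_int (moebius g) / q ^ deg d g"

definition layer :: "nat \<Rightarrow> 'p set \<Rightarrow> nat \<Rightarrow> 'p multiset set" where
  "layer l J x = {g. deg d g \<le> x \<and> (\<forall>P\<in>#g. l \<le> d P) \<and> {P. P \<in># g \<and> d P = l} = J}"

text \<open>Truncated subtraction would yield \<open>M l 0 = 1\<close> for \<open>a > x\<close>,
  where no cofactor exists; the explicit 0 is the value of the empty sum.\<close>

definition Mshift :: "nat \<Rightarrow> nat \<Rightarrow> nat \<Rightarrow> real" where
  "Mshift l a x = (if a \<le> x then M l (x - a) else 0)"

lemma finite_layer [simp]: "finite (layer l J x)"
  by (rule finite_subset[OF _ finite_deg_le[of x]]) (auto simp: layer_def)

lemma M_eq_sum: "M m x = (\<Sum>g | deg d g \<le> x \<and> (\<forall>P\<in>#g. m < d P). wmu g)"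
proof -
  have fin: "finite {g. deg d g \<le> x \<and> (\<forall>P\<in>#g. m < d P)}"
    by (rule finite_subset[OF _ finite_deg_le[of x]]) auto
  have "(\<Sum>g | deg d g \<le> x \<and> (\<forall>P\<in>#g. m < d P). wmu g) =
    (\<Sum>n\<le>x. \<Sum>g | g \<in> {g. deg d g \<le> x \<and> (\<forall>P\<in>#g. m < d P)} \<and> deg d g = n. wmu g)"
    using fin by (intro sum.group[symmetric]) auto
  also have "\<dots> = (\<Sum>n\<le>x. \<Sum>g\<in>rough m n. real_of_int (moebius g) / q ^ n)"
    by (intro sum.cong) (auto simp: rough_def wmu_def)
  finally show ?thesis by (simp add: M_def A_def sum_divide_distrib)
qed

lemma deg_mset_set: "finite J \<Longrightarrow> J \<subseteq> {P. d P = l} \<Longrightarrow> deg d (mset_set J) = l * card J"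
  by (induction J rule: finite_induct) auto

text \<open>A squarefree element of the layer is uniquely the sum of the primes in \<open>J\<close>
  and a cofactor whose primes have degree above \<open>l\<close>. The Moebius function and the norm
  factor accordingly, and other elements contribute 0.\<close>

lemma sum_layer:
  assumes J: "J \<subseteq> {P. d P = l}"
  shows "(\<Sum>g\<in>layer l J x. wmu g) = (-1) ^ card J / q ^ (l * card J) * Mshift l (l * card J) x"
proof -
  have fin: "finite J" using J finite_primes_eq(1) by (rule finite_subset)
  define sqf where "sqf = (\<lambda>g :: 'p multiset. \<forall>P. count g P \<le> 1)"
  define small where "small = (\<lambda>g. filter_mset (\<lambda>P. l < d P) g)"
  have wmu0: "wmu g = 0" if "\<not> sqf g" for g using that by (auto simp: wmu_def moebius_def sqf_def)
  have decomp: "mset_set J + small g = g" if g: "g \<in> layer l J x" "sqf g" for g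
  proof (rule multiset_eqI)
    fix P
    have c: "count g P \<le> 1" using g(2) by (simp add: sqf_def)
    have "l \<le> d P" if "P \<in># g" using that g(1) by (auto simp: layer_def)
    moreover have "P \<in> J \<longleftrightarrow> P \<in># g \<and> d P = l" using g(1) by (auto simp: layer_def)
    ultimately show "count (mset_set J + small g) P = count g P"
      using c fin by (auto simp: small_def count_mset_set' not_in_iff Suc_le_eq le_Suc_eq
          simp flip: count_greater_zero_iff)
  qed
  have "(\<Sum>g\<in>layer l J x. wmu g) = (\<Sum>g | g \<in> layer l J x \<and> sqf g. wmu g)"
    by (rule sum.mono_neutral_right) (auto simp: wmu0)
  also have "\<dots> = (-1) ^ card J / q ^ (l * card J) * Mshift l (l * card J) x"
  proof (cases "l * card J \<le> x")
    case True
    define y where "y = x - l * card J"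
    have "(\<Sum>g | g \<in> layer l J x \<and> sqf g. wmu g) =
        (\<Sum>h | (deg d h \<le> y \<and> (\<forall>P\<in>#h. l < d P)) \<and> sqf h. (-1) ^ card J / q ^ (l * card J) * wmu h)"
    proof (rule sum.reindex_bij_witness[where i = "\<lambda>h. mset_set J + h" and j = small])
      fix g assume g: "g \<in> {g \<in> layer l J x. sqf g}"
      thus eq: "mset_set J + small g = g" using decomp by simp
      have dg: "deg d g = l * card J + deg d (small g)"
        using deg_mset_set[OF fin J] by (subst eq[symmetric]) simp
      have "deg d (small g) \<le> y" using g dg by (auto simp: layer_def y_def)
      moreover have "sqf (small g)" using g by (auto simp: sqf_def small_def)
      ultimately show "small g \<in> {h. (deg d h \<le> y \<and> (\<forall>P\<in>#h. l < d P)) \<and> sqf h}"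
        by (auto simp: small_def)
      have "moebius (mset_set J + small g) = (-1) ^ card J * moebius (small g)"
        using J by (intro moebius_mset_set_union fin) (auto simp: small_def)
      hence "moebius g = (-1) ^ card J * moebius (small g)" unfolding eq .
      thus "(-1) ^ card J / q ^ (l * card J) * wmu (small g) = wmu g"
        by (simp add: wmu_def dg power_add)
    next
      fix h assume h: "h \<in> {h. (deg d h \<le> y \<and> (\<forall>P\<in>#h. l < d P)) \<and> sqf h}"
      have "filter_mset (\<lambda>P. l < d P) (mset_set J) = {#}"
        using J fin by (intro multiset_eqI) (auto simp: count_mset_set')
      moreover have "filter_mset (\<lambda>P. l < d P) h = h"
        using h by (simp add: filter_mset_eq_conv)
      ultimately show "small (mset_set J + h) = h" by (simp add: small_def)
      have "deg d (mset_set J + h) \<le> x"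
        using h True deg_mset_set[OF fin J] by (auto simp: y_def)
      moreover have "sqf (mset_set J + h)"
        unfolding sqf_def
      proof
        fix P
        have "P \<notin># h" if "P \<in> J" using that h J by auto
        thus "count (mset_set J + h) P \<le> 1"
          using h fin by (cases "P \<in> J") (auto simp: sqf_def not_in_iff)
      qed
      ultimately show "mset_set J + h \<in> {g \<in> layer l J x. sqf g}"
        using h J fin by (auto simp: layer_def)
    qed
    also have "\<dots> = (\<Sum>h | deg d h \<le> y \<and> (\<forall>P\<in>#h. l < d P). (-1) ^ card J / q ^ (l * card J) * wmu h)"
      by (intro sum.mono_neutral_left finite_subset[OF _ finite_deg_le[of y]]) (use wmu0 in auto)
    finally show ?thesis using True
      by (simp add: Mshift_def M_eq_sum y_def sum_distrib_left)
  next
    case False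
    have "{g \<in> layer l J x. sqf g} = {}"
    proof -
      have "l * card J \<le> x" if "g \<in> layer l J x" "sqf g" for g
      proof -
        have "deg d g = l * card J + deg d (small g)"
          using deg_mset_set[OF fin J] by (subst decomp[OF that, symmetric]) simp
        thus ?thesis using that by (simp add: layer_def)
      qed
      thus ?thesis using False by auto
    qed
    hence "(\<Sum>g | g \<in> layer l J x \<and> sqf g. wmu g) = 0" by (simp only: sum.empty)
    thus ?thesis using False by (simp add: Mshift_def)
  qed
  finally show ?thesis .
qed

section \<open>Leading primes and distinguishable elements\<close>

definition leads :: "'p \<Rightarrow> 'p multiset \<Rightarrow> bool" where
  "leads P g \<longleftrightarrow> P \<in># g \<and> (\<forall>Q\<in>#g. Q \<noteq> P \<longrightarrow> d P < d Q)"

lemma leads_unique: "leads P g \<Longrightarrow> leads Q g \<Longrightarrow> P = Q"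
  unfolding leads_def by (metis less_asym)

lemma layer_singleton: "layer (d P) {P} x = {g. deg d g \<le> x \<and> leads P g}"
  by (auto simp: layer_def leads_def set_eq_iff less_le)

lemma d_minus_attained:
  assumes "g \<noteq> {#}"
  shows "\<exists>P\<in>#g. d P = d_minus d g" "\<And>P. P \<in># g \<Longrightarrow> d_minus d g \<le> d P"
proof -
  have "Min (d ` set_mset g) \<in> d ` set_mset g" using assms by (intro Min_in) auto
  thus "\<exists>P\<in>#g. d P = d_minus d g" by (auto simp: d_minus_def)
  show "d_minus d g \<le> d P" if "P \<in># g" for P using that by (simp add: d_minus_def)
qed

text \<open>A prime leads \<open>g\<close> exactly if it alone attains \<open>d_minus d g\<close>,
  whatever its multiplicity. This replaces the definite description in \<open>P_min\<close> by a
  relation that is easier to handle.\<close>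

lemma in_DS_iff: "g \<in> DS d S \<longleftrightarrow> g = {#} \<or> (\<exists>P\<in>S. leads P g)"
proof (cases "g = {#}")
  case False
  note min = d_minus_attained[OF False]
  have leads_min: "leads P g \<longleftrightarrow> P \<in># g \<and> d P = d_minus d g \<and> (\<forall>Q. Q \<in># g \<and> d Q = d_minus d g \<longrightarrow> Q = P)" for P
  proof
    assume P: "leads P g"
    obtain Q where Q: "Q \<in># g" "d Q = d_minus d g" using min(1) by blast
    have "d P = d_minus d g"
      using P Q min(2)[of P] unfolding leads_def by (metis not_less)
    thus "P \<in># g \<and> d P = d_minus d g \<and> (\<forall>Q. Q \<in># g \<and> d Q = d_minus d g \<longrightarrow> Q = P)"
      using P unfolding leads_def by (metis less_irrefl)
  next
    assume "P \<in># g \<and> d P = d_minus d g \<and> (\<forall>Q. Q \<in># g \<and> d Q = d_minus d g \<longrightarrow> Q = P)"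
    thus "leads P g" unfolding leads_def using min(2) by (metis le_neq_implies_less)
  qed
  hence dist: "distinguishable d g \<longleftrightarrow> (\<exists>P. leads P g)"
    using False unfolding distinguishable_def by metis
  have "P_min d g = P" if "leads P g" for P
    unfolding P_min_def using that leads_min[of P] by (intro the_equality) auto
  thus ?thesis using dist False unfolding DS_def by auto
qed (simp add: DS_def)

lemma not_leads_empty [simp]: "\<not> leads P {#}"
  by (simp add: leads_def)

lemma sum_leads: "(\<Sum>g | deg d g \<le> x \<and> leads P g. wmu g) = - Mshift (d P) (d P) x / q ^ d P"
  using sum_layer[of "{P}" "d P" x] by (simp add: layer_singleton)

lemma sum_leads_in:
  assumes "finite T"
  shows "(\<Sum>g | deg d g \<le> x \<and> (\<exists>P\<in>T. leads P g). wmu g) = (\<Sum>P\<in>T. - Mshift (d P) (d P) x / q ^ d P)"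
proof -
  have "{g. deg d g \<le> x \<and> (\<exists>P\<in>T. leads P g)} = (\<Union>P\<in>T. {g. deg d g \<le> x \<and> leads P g})" by auto
  moreover have "finite {g. deg d g \<le> x \<and> leads P g}" for P
    by (rule finite_subset[OF _ finite_deg_le[of x]]) auto
  ultimately have "(\<Sum>g | deg d g \<le> x \<and> (\<exists>P\<in>T. leads P g). wmu g) =
      (\<Sum>P\<in>T. \<Sum>g | deg d g \<le> x \<and> leads P g. wmu g)"
    using assms by (simp only:) (rule sum.UNION_disjoint, auto dest: leads_unique)
  thus ?thesis by (simp only: sum_leads)
qed

lemma sum_by_degree:
  fixes f :: "nat \<Rightarrow> real"
  shows "(\<Sum>P | P \<in> S \<and> d P \<le> n. f (d P)) = (\<Sum>l=1..n. real (card {P \<in> S. d P = l}) * f l)"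
proof -
  have "finite {P. P \<in> S \<and> d P \<le> n}" using finite_primes[of n] by simp
  hence "(\<Sum>P | P \<in> S \<and> d P \<le> n. f (d P)) =
      (\<Sum>l\<in>{1..n}. \<Sum>P | P \<in> {P. P \<in> S \<and> d P \<le> n} \<and> d P = l. f (d P))"
    using d_pos by (intro sum.group[symmetric]) (auto simp: Suc_le_eq)
  also have "\<dots> = (\<Sum>l\<in>{1..n}. \<Sum>P | P \<in> S \<and> d P = l. f l)"
    by (intro sum.cong) auto
  finally show ?thesis by simp
qed

text \<open>A distinguishable element has exactly one leading prime, and the elements led by
  \<open>P\<close> are summed by \<open>sum_leads\<close>. Primes of equal degree contribute
  equally.\<close>

lemma sum_DS:
  "(\<Sum>g | 1 \<le> deg d g \<and> deg d g \<le> n \<and> g \<in> DS d S. wmu g) =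
   - (\<Sum>l=1..n. real (card {P \<in> S. d P = l}) / q ^ l * M l (n - l))"
proof -
  have "{g. 1 \<le> deg d g \<and> deg d g \<le> n \<and> g \<in> DS d S} =
      {g. deg d g \<le> n \<and> (\<exists>P\<in>{P. P \<in> S \<and> d P \<le> n}. leads P g)}"
  proof -
    have "1 \<le> deg d g \<and> g \<in> DS d S \<longleftrightarrow> (\<exists>P\<in>{P. P \<in> S \<and> d P \<le> n}. leads P g)" if "deg d g \<le> n" for g
      using that by (auto simp: in_DS_iff Suc_le_eq deg_pos_iff)
        (metis le_deg leads_def order_trans)
    thus ?thesis by auto
  qed
  moreover have "finite {P. P \<in> S \<and> d P \<le> n}" using finite_primes[of n] by simp
  ultimately have "(\<Sum>g | 1 \<le> deg d g \<and> deg d g \<le> n \<and> g \<in> DS d S. wmu g) =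
      (\<Sum>P | P \<in> S \<and> d P \<le> n. - Mshift (d P) (d P) n / q ^ d P)"
    by (simp only: sum_leads_in)
  also have "\<dots> = (\<Sum>l=1..n. real (card {P \<in> S. d P = l}) * (- Mshift l l n / q ^ l))"
    by (rule sum_by_degree)
  also have "\<dots> = (\<Sum>l=1..n. - (real (card {P \<in> S. d P = l}) / q ^ l * M l (n - l)))"
    by (intro sum.cong) (auto simp: Mshift_def)
  finally show ?thesis by (simp add: sum_negf)
qed

text \<open>Every element other than the identity lies in exactly one layer: \<open>l\<close> is its
  minimal degree and \<open>J\<close> the set of its primes of that degree. The identity yields the
  total mass of the Toeplitz weights.\<close>

lemma M_layers:
  "M 0 n = 1 + (\<Sum>l=1..n. \<Sum>J\<in>Pow {P. d P = l} - {{}}. \<Sum>g\<in>layer l J n. wmu g)"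
proof -
  define E where "E = {g. deg d g \<le> n \<and> g \<noteq> {#}}"
  define key where "key = (\<lambda>g. (d_minus d g, {P. P \<in># g \<and> d P = d_minus d g}))"
  define T where "T = Sigma {1..n} (\<lambda>l. Pow {P. d P = l} - {{}})"
  have finE: "finite E" using finite_deg_le[of n] unfolding E_def by simp
  have "M 0 n = (\<Sum>g | deg d g \<le> n. wmu g)" using d_pos by (simp add: M_eq_sum)
  also have "{g. deg d g \<le> n} = insert {#} E" by (auto simp: E_def)
  also have "sum wmu (insert {#} E) = 1 + sum wmu E"
    using finE by (subst sum.insert) (auto simp: E_def wmu_def)
  also have "sum wmu E = (\<Sum>t\<in>T. \<Sum>g | g \<in> E \<and> key g = t. wmu g)"
  proof (rule sum.group[symmetric, OF finE])
    show "finite T" unfolding T_def by (intro finite_SigmaI) auto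
    show "key ` E \<subseteq> T"
    proof
      fix t assume "t \<in> key ` E"
      then obtain g where g: "g \<in> E" "t = key g" by blast
      then obtain P where P: "P \<in># g" "d P = d_minus d g"
        using d_minus_attained(1)[of g] by (auto simp: E_def)
      have "d P \<le> n" using P g le_deg[of P g d] by (auto simp: E_def)
      thus "t \<in> T" using P g d_pos[of P] by (auto simp: T_def key_def)
    qed
  qed
  also have "\<dots> = (\<Sum>(l, J)\<in>T. \<Sum>g\<in>layer l J n. wmu g)"
  proof (intro sum.cong refl, clarify)
    fix l J assume lJ: "(l, J) \<in> T"
    have "{g \<in> E. key g = (l, J)} = layer l J n"
    proof (intro equalityI subsetI)
      fix g assume g: "g \<in> {g \<in> E. key g = (l, J)}"
      thus "g \<in> layer l J n"
        using d_minus_attained(2)[of g] by (auto simp: layer_def E_def key_def)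
    next
      fix g assume g: "g \<in> layer l J n"
      obtain P where P: "P \<in># g" "d P = l" using g lJ by (auto simp: layer_def T_def)
      hence ne: "g \<noteq> {#}" by auto
      have "d_minus d g = l"
      proof (rule antisym)
        show "d_minus d g \<le> l" using d_minus_attained(2)[OF ne P(1)] P(2) by simp
        show "l \<le> d_minus d g" using d_minus_attained(1)[OF ne] g by (auto simp: layer_def)
      qed
      thus "g \<in> {g \<in> E. key g = (l, J)}" using g ne by (auto simp: layer_def E_def key_def)
    qed
    thus "(\<Sum>g | g \<in> E \<and> key g = (l, J). wmu g) = (\<Sum>g\<in>layer l J n. wmu g)"
      by (simp only:)
  qed
  also have "\<dots> = (\<Sum>l=1..n. \<Sum>J\<in>Pow {P. d P = l} - {{}}. \<Sum>g\<in>layer l J n. wmu g)"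
    unfolding T_def by (rule sum.Sigma[symmetric]) auto
  finally show ?thesis .
qed

end

section \<open>Limits of sums over distinguishable elements\<close>

context pnt_semigroup
begin

lemma Mshift_bounded: "\<exists>B>0. \<forall>l a x. \<bar>Mshift l a x\<bar> \<le> B"
  using M_bounded unfolding Mshift_def by (metis abs_zero less_eq_real_def)

lemma Mshift_tendsto_0: "Mshift l a \<longlonglongrightarrow> 0"
proof -
  have "(\<lambda>x. M l (x - a)) \<longlonglongrightarrow> 0"
    by (rule filterlim_compose[OF M_tendsto_0 filterlim_minus_const_nat_at_top])
  moreover have "\<forall>\<^sub>F x in sequentially. M l (x - a) = Mshift l a x"
    using eventually_ge_at_top[of a] by eventually_elim (simp add: Mshift_def)
  ultimately show ?thesis by (rule Lim_transform_eventually)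
qed

text \<open>For 0 \<le> t \<le> 1 the remainder e^t - 1 - t is at most t^2, and
  \<open>\<phi> l\<close> is O(1/l).\<close>

lemma summable_exp_\<phi>: "summable (\<lambda>l. exp (\<phi> l) - 1 - \<phi> l)"
proof -
  obtain C where C: "C > 0" "\<And>m. m > 0 \<Longrightarrow> \<phi> m \<le> C / real m" using \<phi>_le by blast
  show ?thesis
  proof (rule summable_comparison_test_ev)
    have "summable (\<lambda>n. 1 / real n ^ 2)" using inverse_power_summable[of 2, where 'a = real]
      by (simp add: inverse_eq_divide power_one_over)
    thus "summable (\<lambda>n. C\<^sup>2 * (1 / real n ^ 2))" by (rule summable_mult)
    show "\<forall>\<^sub>F n in sequentially. norm (exp (\<phi> n) - 1 - \<phi> n) \<le> C\<^sup>2 * (1 / real n ^ 2)"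
      using eventually_gt_at_top[of "nat \<lceil>C\<rceil>"]
    proof eventually_elim
      case (elim n)
      hence n: "n > 0" "C < real n" by linarith+
      have le: "\<phi> n \<le> C / real n" using C n by auto
      also have "\<dots> \<le> 1" using n by simp
      finally have "\<phi> n \<le> 1" .
      hence "exp (\<phi> n) \<le> 1 + \<phi> n + (\<phi> n)\<^sup>2" by (intro exp_bound \<phi>_nonneg)
      moreover have "1 + \<phi> n \<le> exp (\<phi> n)" by (rule exp_ge_add_one_self)
      moreover have "(\<phi> n)\<^sup>2 \<le> (C / real n)\<^sup>2" using le by (intro power_mono \<phi>_nonneg)
      ultimately show ?case
        unfolding real_norm_def power_divide times_divide_eq_right mult_1_right by linarith
    qed
  qed
qed

text \<open>In \<open>M_layers\<close> the singletons \<open>J\<close> produce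
  \<open>- \<phi> l * M l (n - l)\<close>, so the sum equals 1 - M(0, n) plus the layers with at
  least two minimal primes. Both corrections tend to 0, the second by domination.\<close>

lemma weighted_M_tendsto_1: "(\<lambda>n. \<Sum>l=1..n. \<phi> l * M l (n - l)) \<longlonglongrightarrow> 1"
proof -
  define f where "f = (\<lambda>l n. \<Sum>J | J \<subseteq> {P. d P = l} \<and> card J \<ge> 2. \<Sum>g\<in>layer l J n. wmu g)"
  have finJ: "finite {J. J \<subseteq> {P. d P = l} \<and> card J \<ge> 2}" for l by simp
  have layers: "(\<Sum>J\<in>Pow {P. d P = l} - {{}}. \<Sum>g\<in>layer l J n. wmu g) = f l n - \<phi> l * M l (n - l)"
    if l: "l \<in> {1..n}" for l n
  proof -
    have set: "Pow {P. d P = l} - {{}} = {J. J \<subseteq> {P. d P = l} \<and> card J \<ge> 2} \<union> (\<lambda>P. {P}) ` {P. d P = l}"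
    proof (intro equalityI subsetI)
      fix J assume J: "J \<in> Pow {P. d P = l} - {{}}"
      hence "finite J" using finite_primes_eq(1)[of l] by (meson DiffD1 PowD finite_subset)
      hence "card J \<noteq> 0" using J by auto
      hence "card J = 1 \<or> card J \<ge> 2" by linarith
      thus "J \<in> {J. J \<subseteq> {P. d P = l} \<and> card J \<ge> 2} \<union> (\<lambda>P. {P}) ` {P. d P = l}"
        using J by (auto simp: card_1_singleton_iff)
    qed auto
    have "(\<Sum>J\<in>Pow {P. d P = l} - {{}}. \<Sum>g\<in>layer l J n. wmu g) =
        f l n + (\<Sum>J\<in>(\<lambda>P. {P}) ` {P. d P = l}. \<Sum>g\<in>layer l J n. wmu g)"
      unfolding f_def set by (intro sum.union_disjoint finJ finite_imageI) auto
    also have "(\<Sum>J\<in>(\<lambda>P. {P}) ` {P. d P = l}. \<Sum>g\<in>layer l J n. wmu g) =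
        (\<Sum>P | d P = l. - M l (n - l) / q ^ l)"
      using l by (subst sum.reindex) (auto simp: inj_on_def sum_layer Mshift_def)
    finally show ?thesis by (simp add: \<phi>_def)
  qed
  have eq: "(\<Sum>l=1..n. \<phi> l * M l (n - l)) = 1 - M 0 n + (\<Sum>l=1..n. f l n)" for n
    unfolding M_layers by (simp add: layers sum_subtractf)
  obtain B where B: "B > 0" "\<And>l a x. \<bar>Mshift l a x\<bar> \<le> B" using Mshift_bounded by blast
  have "(\<lambda>n. \<Sum>l=1..n. f l n) \<longlonglongrightarrow> 0"
  proof (rule sum_tendsto_0_dominated)
    show "(\<lambda>n. f l n) \<longlonglongrightarrow> 0" for l
    proof -
      have "(\<lambda>n. \<Sum>J | J \<subseteq> {P. d P = l} \<and> card J \<ge> 2.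
          (-1) ^ card J / q ^ (l * card J) * Mshift l (l * card J) n) \<longlonglongrightarrow>
          (\<Sum>J | J \<subseteq> {P. d P = l} \<and> card J \<ge> 2. (-1) ^ card J / q ^ (l * card J) * 0)"
        by (intro tendsto_sum tendsto_mult tendsto_const Mshift_tendsto_0)
      thus ?thesis by (simp add: f_def sum_layer)
    qed
    show "norm (f l n) \<le> B * (exp (\<phi> l) - 1 - \<phi> l)" if "1 \<le> l" "l \<le> n" for l n
    proof -
      define t where "t = 1 / q ^ l"
      define X where "X = {P. d P = l}"
      have finX: "finite X" by (simp add: X_def)
      have t: "t \<ge> 0" using q_pos by (simp add: t_def)
      have "norm (f l n) \<le> (\<Sum>J | J \<subseteq> X \<and> card J \<ge> 2. B * t ^ card J)"
        unfolding f_def X_def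
      proof (rule sum_norm_le)
        fix J assume J: "J \<in> {J. J \<subseteq> {P. d P = l} \<and> card J \<ge> 2}"
        hence "norm (\<Sum>g\<in>layer l J n. wmu g) = t ^ card J * \<bar>Mshift l (l * card J) n\<bar>"
          using q_pos by (simp add: sum_layer abs_mult abs_divide power_abs t_def power_divide power_mult)
        thus "norm (\<Sum>g\<in>layer l J n. wmu g) \<le> B * t ^ card J"
          using mult_left_mono[OF B(2)[of l "l * card J" n], of "t ^ card J"] t by (simp add: mult.commute)
      qed
      also have "\<dots> = B * (\<Sum>J | J \<subseteq> X \<and> card J \<ge> 2. t ^ card J)"
        by (simp add: sum_distrib_left)
      \<comment> \<open>The sum over all subsets is (1 + t)^|X|, at most e^(t |X|) with t |X| =
        \<open>\<phi> l\<close>. Subsets of size 0 and 1 account for 1 and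
        \<open>\<phi> l\<close>.\<close>
      also have "(\<Sum>J | J \<subseteq> X \<and> card J \<ge> 2. t ^ card J) \<le> exp (\<phi> l) - 1 - \<phi> l"
      proof -
        have set: "Pow X = {J. J \<subseteq> X \<and> card J \<ge> 2} \<union> insert {} ((\<lambda>P. {P}) ` X)"
        proof (intro equalityI subsetI)
          fix J assume J: "J \<in> Pow X"
          hence "finite J" using finX by (meson PowD finite_subset)
          hence "J = {} \<or> card J \<noteq> 0" by auto
          hence "J = {} \<or> card J = 1 \<or> card J \<ge> 2" by linarith
          thus "J \<in> {J. J \<subseteq> X \<and> card J \<ge> 2} \<union> insert {} ((\<lambda>P. {P}) ` X)"
            using J by (auto simp: card_1_singleton_iff)
        qed auto
        have "(\<Sum>J\<in>Pow X. t ^ card J) =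
            (\<Sum>J | J \<subseteq> X \<and> card J \<ge> 2. t ^ card J) + (\<Sum>J\<in>insert {} ((\<lambda>P. {P}) ` X). t ^ card J)"
          unfolding set using finX by (intro sum.union_disjoint) auto
        also have "(\<Sum>J\<in>insert {} ((\<lambda>P. {P}) ` X). t ^ card J) = 1 + (\<Sum>J\<in>(\<lambda>P. {P}) ` X. t ^ card J)"
          using finX by (subst sum.insert) auto
        also have "(\<Sum>J\<in>(\<lambda>P. {P}) ` X. t ^ card J) = \<phi> l"
          by (subst sum.reindex) (auto simp: inj_on_def \<phi>_def X_def t_def)
        finally have "(\<Sum>J | J \<subseteq> X \<and> card J \<ge> 2. t ^ card J) = (1 + t) ^ card X - 1 - \<phi> l"
          by (simp add: sum_Pow_power_card[OF finX])
        moreover have "(1 + t) ^ card X \<le> exp t ^ card X"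
          using t by (intro power_mono exp_ge_add_one_self) auto
        moreover have "exp t ^ card X = exp (\<phi> l)"
          by (simp add: \<phi>_def X_def t_def flip: exp_of_nat_mult)
        ultimately show ?thesis by simp
      qed
      finally show ?thesis using B(1) by (simp add: mult_left_mono)
    qed
    show "summable (\<lambda>l. B * (exp (\<phi> l) - 1 - \<phi> l))" by (intro summable_mult summable_exp_\<phi>)
  qed
  hence "(\<lambda>n. 1 - M 0 n + (\<Sum>l=1..n. f l n)) \<longlonglongrightarrow> 1 - 0 + 0"
    by (intro tendsto_intros M_tendsto_0)
  thus ?thesis unfolding eq by simp
qed

lemma sum_DS_tendsto:
  assumes "nat_density d S \<delta>"
  shows "(\<lambda>n. - (\<Sum>g | 1 \<le> deg d g \<and> deg d g \<le> n \<and> g \<in> DS d S. wmu g)) \<longlonglongrightarrow> \<delta>"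
proof -
  obtain W where W: "\<And>n. (\<Sum>l=1..n. \<phi> l * \<bar>M l (n - l)\<bar>) \<le> W" using weighted_M_bounded by blast
  define s where "s = (\<lambda>n. real (card {P \<in> S. d P = n}) / real (card {P. d P = n}))"
  have "(\<lambda>n. \<Sum>l=1..n. s l * (\<phi> l * M l (n - l))) \<longlonglongrightarrow> \<delta>"
  proof (rule toeplitz_weighted_limit)
    show "(\<Sum>l=1..n. \<bar>\<phi> l * M l (n - l)\<bar>) \<le> W" for n
      using W[of n] \<phi>_nonneg by (simp add: abs_mult)
    show "(\<lambda>n. \<phi> l * M l (n - l)) \<longlonglongrightarrow> 0" for l
      by (intro tendsto_mult_right_zero filterlim_compose[OF M_tendsto_0 filterlim_minus_const_nat_at_top])
    show "s \<longlonglongrightarrow> \<delta>" using assms by (simp add: nat_density_def s_def)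
  qed (rule weighted_M_tendsto_1)
  \<comment> \<open>If there is no prime of degree \<open>l\<close>, the quotient \<open>s l\<close>
    is 0 by convention and both sides vanish.\<close>
  moreover have "s l * \<phi> l = real (card {P \<in> S. d P = l}) / q ^ l" for l
  proof (cases "card {P. d P = l} = 0")
    case True
    moreover have "card {P \<in> S. d P = l} \<le> card {P. d P = l}" by (intro card_mono) auto
    ultimately show ?thesis by (simp add: s_def)
  qed (simp add: s_def \<phi>_def)
  ultimately show ?thesis unfolding sum_DS by (simp flip: mult.assoc)
qed

text \<open>The factor of a(k) / |k| once the convolution sum is reordered by \<open>k\<close>;
  \<open>x\<close> limits the degree of \<open>h\<close> alone.\<close>

definition U :: "'p set \<Rightarrow> 'p multiset \<Rightarrow> nat \<Rightarrow> real" where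
  "U S k x = (\<Sum>h | deg d h \<le> x \<and> h + k \<in> DS d S. wmu h)"

text \<open>With \<open>P\<close> leading \<open>k\<close>, the sum \<open>h + k\<close> stays in
  \<open>DS d S\<close> in three disjoint cases: all primes of \<open>h\<close> have degree above
  \<open>d P\<close>, \<open>P\<close> leads \<open>h\<close>, or a prime of \<open>S\<close> of
  smaller degree leads \<open>h\<close>. They give the three terms.\<close>

lemma U_eq:
  assumes P: "P \<in> S" "leads P k"
  shows "U S k x = M (d P) x - Mshift (d P) (d P) x / q ^ d P
           - (\<Sum>Q | Q \<in> S \<and> d Q < d P. Mshift (d Q) (d Q) x / q ^ d Q)"
proof -
  define R where "R = {h. deg d h \<le> x \<and> (\<forall>Q\<in>#h. d P < d Q)}"
  define T where "T = insert P {Q. Q \<in> S \<and> d Q < d P}"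
  define L where "L = {h. deg d h \<le> x \<and> (\<exists>Q\<in>T. leads Q h)}"
  have finT: "finite T" unfolding T_def
    by (intro finite.insertI finite_subset[OF _ finite_primes[of "d P"]]) auto
  have fin: "finite R" "finite L"
    by (rule finite_subset[OF _ finite_deg_le[of x]]; auto simp: R_def L_def)+
  have "h + k \<in> DS d S \<longleftrightarrow> (\<forall>Q\<in>#h. d P < d Q) \<or> (\<exists>Q\<in>T. leads Q h)" for h
  proof
    assume "h + k \<in> DS d S"
    moreover have "h + k \<noteq> {#}" using P(2) by auto
    ultimately obtain Q where Q: "Q \<in> S" "leads Q (h + k)" by (auto simp: in_DS_iff)
    show "(\<forall>Q\<in>#h. d P < d Q) \<or> (\<exists>Q\<in>T. leads Q h)"
    proof (cases "Q = P")
      case True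
      show ?thesis
      proof (cases "P \<in># h")
        case True
        hence "leads P h" using Q(2) \<open>Q = P\<close> by (auto simp: leads_def)
        thus ?thesis by (auto simp: T_def)
      next
        case False
        hence "\<forall>Q\<in>#h. d P < d Q" using Q(2) \<open>Q = P\<close> by (auto simp: leads_def)
        thus ?thesis ..
      qed
    next
      case False
      have "d Q < d P" using Q(2) P(2) False by (auto simp: leads_def)
      moreover have "Q \<notin># k" using P(2) \<open>d Q < d P\<close> by (auto simp: leads_def)
      hence "leads Q h" using Q(2) by (auto simp: leads_def)
      ultimately show ?thesis using Q(1) by (auto simp: T_def)
    qed
  next
    assume "(\<forall>Q\<in>#h. d P < d Q) \<or> (\<exists>Q\<in>T. leads Q h)"
    thus "h + k \<in> DS d S"
    proof
      assume "\<forall>Q\<in>#h. d P < d Q"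
      hence "leads P (h + k)" using P(2) by (auto simp: leads_def)
      thus ?thesis using P(1) by (auto simp: in_DS_iff)
    next
      assume "\<exists>Q\<in>T. leads Q h"
      then obtain Q where Q: "Q \<in> T" "leads Q h" by blast
      have "leads Q (h + k)"
      proof (cases "Q = P")
        case True
        thus ?thesis using Q P by (auto simp: leads_def)
      next
        case False
        hence dQ: "d Q < d P" using Q by (auto simp: T_def)
        have "d Q < d X" if "X \<in># k" for X
          using P(2) that dQ unfolding leads_def by (cases "X = P") (auto intro: less_trans)
        thus ?thesis using Q(2) by (auto simp: leads_def)
      qed
      thus ?thesis using Q(1) P(1) by (auto simp: in_DS_iff T_def)
    qed
  qed
  hence "{h. deg d h \<le> x \<and> h + k \<in> DS d S} = R \<union> L" by (auto simp: R_def L_def)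
  moreover have "R \<inter> L = {}"
  proof -
    have False if "h \<in> R" "h \<in> L" for h
    proof -
      from that obtain Q where "Q \<in> T" "leads Q h" by (auto simp: L_def)
      hence "d Q \<le> d P" "Q \<in># h" by (auto simp: T_def leads_def)
      thus False using that(1) by (auto simp: R_def)
    qed
    thus ?thesis by auto
  qed
  ultimately have "U S k x = sum wmu R + sum wmu L"
    unfolding U_def using fin by (simp only: sum.union_disjoint)
  also have "sum wmu R = M (d P) x" by (simp add: R_def M_eq_sum)
  also have "sum wmu L = (\<Sum>Q\<in>T. - Mshift (d Q) (d Q) x / q ^ d Q)"
    unfolding L_def by (rule sum_leads_in[OF finT])
  also have "\<dots> = - Mshift (d P) (d P) x / q ^ d P
      - (\<Sum>Q | Q \<in> S \<and> d Q < d P. Mshift (d Q) (d Q) x / q ^ d Q)"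
    unfolding T_def using finT by (subst sum.insert) (auto simp: T_def sum_negf)
  finally show ?thesis by simp
qed

text \<open>The bound must not depend on \<open>k\<close>. Since \<open>Mshift\<close> vanishes for
  degrees above \<open>x\<close>, the sum over \<open>Q\<close> is dominated by the full weighted
  sum at \<open>x\<close>, whatever \<open>P\<close> is.\<close>

lemma U_bounded: "\<exists>B>0. \<forall>k x. k \<in> DS d S \<longrightarrow> k \<noteq> {#} \<longrightarrow> \<bar>U S k x\<bar> \<le> B"
proof -
  obtain B where B: "B > 0" "\<And>m x. \<bar>M m x\<bar> \<le> B" using M_bounded by blast
  obtain B' where B': "B' > 0" "\<And>l a x. \<bar>Mshift l a x\<bar> \<le> B'" using Mshift_bounded by blast
  obtain W where W: "W > 0" "\<And>n. (\<Sum>l=1..n. \<phi> l * \<bar>M l (n - l)\<bar>) \<le> W"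
    using weighted_M_bounded by blast
  have "\<bar>U S k x\<bar> \<le> B + B' + W" if k: "k \<in> DS d S" "k \<noteq> {#}" for k x
  proof -
    obtain P where P: "P \<in> S" "leads P k" using k by (auto simp: in_DS_iff)
    have "\<bar>Mshift (d P) (d P) x / q ^ d P\<bar> \<le> B'"
    proof -
      have "\<bar>Mshift (d P) (d P) x\<bar> / q ^ d P \<le> \<bar>Mshift (d P) (d P) x\<bar> / 1"
        using q_gt_1 by (intro divide_left_mono) auto
      thus ?thesis using B'(2)[of "d P" "d P" x] q_pos by (simp add: abs_divide)
    qed
    moreover have "\<bar>\<Sum>Q | Q \<in> S \<and> d Q < d P. Mshift (d Q) (d Q) x / q ^ d Q\<bar> \<le> W"
    proof -
      have fin: "finite {Q. Q \<in> S \<and> d Q < d P}" "finite {Q. Q \<in> UNIV \<and> d Q \<le> x}"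
        using finite_primes[of x] by (auto intro: finite_subset[OF _ finite_primes[of "d P"]])
      have "\<bar>\<Sum>Q | Q \<in> S \<and> d Q < d P. Mshift (d Q) (d Q) x / q ^ d Q\<bar> \<le>
          (\<Sum>Q | Q \<in> S \<and> d Q < d P. \<bar>Mshift (d Q) (d Q) x / q ^ d Q\<bar>)"
        by (rule sum_abs)
      also have "\<dots> = (\<Sum>Q | Q \<in> S \<and> d Q < d P \<and> d Q \<le> x. \<bar>Mshift (d Q) (d Q) x / q ^ d Q\<bar>)"
        using fin by (intro sum.mono_neutral_right) (auto simp: Mshift_def)
      also have "\<dots> \<le> (\<Sum>Q | Q \<in> UNIV \<and> d Q \<le> x. \<bar>Mshift (d Q) (d Q) x / q ^ d Q\<bar>)"
        using fin by (intro sum_mono2) auto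
      also have "\<dots> = (\<Sum>l=1..x. real (card {P \<in> UNIV. d P = l}) * \<bar>Mshift l l x / q ^ l\<bar>)"
        by (rule sum_by_degree)
      also have "\<dots> = (\<Sum>l=1..x. \<phi> l * \<bar>M l (x - l)\<bar>)"
        using q_pos by (intro sum.cong) (auto simp: Mshift_def \<phi>_def abs_divide)
      also have "\<dots> \<le> W" by (rule W)
      finally show ?thesis .
    qed
    ultimately show ?thesis unfolding U_eq[OF P] using B(2)[of "d P" x] by linarith
  qed
  thus ?thesis using B(1) B'(1) W(1) by (intro exI[of _ "B + B' + W"]) auto
qed

lemma U_tendsto_0:
  assumes "k \<in> DS d S" "k \<noteq> {#}"
  shows "U S k \<longlonglongrightarrow> 0"
proof -
  obtain P where P: "P \<in> S" "leads P k" using assms by (auto simp: in_DS_iff)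
  have "(\<lambda>x. M (d P) x - Mshift (d P) (d P) x / q ^ d P
           - (\<Sum>Q | Q \<in> S \<and> d Q < d P. Mshift (d Q) (d Q) x / q ^ d Q)) \<longlonglongrightarrow>
        0 - 0 / q ^ d P - (\<Sum>Q | Q \<in> S \<and> d Q < d P. 0 / q ^ d Q)"
    by (intro tendsto_diff tendsto_sum tendsto_divide tendsto_const M_tendsto_0 Mshift_tendsto_0) auto
  moreover have "U S k = (\<lambda>x. M (d P) x - Mshift (d P) (d P) x / q ^ d P
           - (\<Sum>Q | Q \<in> S \<and> d Q < d P. Mshift (d Q) (d Q) x / q ^ d Q))"
    by (rule ext) (rule U_eq[OF P])
  ultimately show ?thesis by simp
qed

section \<open>Reordering the convolution sum and passing to the limit\<close>

lemma finite_submultisets: "finite {h. h \<subseteq># (g :: 'p multiset)}"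
proof (rule finite_subset[OF _ finite_deg_le[of "deg d g"]], clarify)
  fix h assume "h \<subseteq># g"
  then obtain r where "g = h + r" by (metis subset_mset.le_iff_add)
  thus "deg d h \<le> deg d g" by simp
qed

text \<open>Write \<open>g = h + k\<close> and sum over \<open>h\<close> first. The cofactor
  \<open>k = {#}\<close> gives the pure Moebius sum, and the other cofactors in the support are
  grouped by their degree \<open>j\<close>.\<close>

lemma sum_mconv:
  assumes supp: "\<And>g. g \<notin> DS d S \<Longrightarrow> a g = 0" and a0: "a {#} = 1"
  shows "(\<Sum>g | 1 \<le> deg d g \<and> deg d g \<le> n \<and> g \<in> DS d S. mconv a g / of_real (gnorm d q g)) =
    of_real (\<Sum>g | 1 \<le> deg d g \<and> deg d g \<le> n \<and> g \<in> DS d S. wmu g) +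
    (\<Sum>j=1..n. \<Sum>k | k \<in> DS d S \<and> deg d k = j. a k / of_real (q ^ j) * of_real (U S k (n - j)))"
proof -
  define E where "E = {g. 1 \<le> deg d g \<and> deg d g \<le> n \<and> g \<in> DS d S}"
  define V where "V = (\<lambda>k. {h. h + k \<in> E})"
  have finE: "finite E" by (rule finite_subset[OF _ finite_deg_le[of n]]) (auto simp: E_def)
  have finV: "finite (V k)" for k
    by (rule finite_subset[OF _ finite_deg_le[of n]]) (auto simp: E_def V_def)
  have fin_le: "finite {k :: 'p multiset. deg d k \<le> n}" by (rule finite_deg_le)
  have "(\<Sum>g\<in>E. mconv a g / of_real (gnorm d q g)) =
      (\<Sum>g\<in>E. \<Sum>h | h \<subseteq># g. of_int (moebius h) * a (g - h) / of_real (q ^ deg d g))"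
    by (simp add: mconv_def gnorm_def sum_divide_distrib)
  also have "\<dots> = (\<Sum>(g, h)\<in>Sigma E (\<lambda>g. {h. h \<subseteq># g}). of_int (moebius h) * a (g - h) / of_real (q ^ deg d g))"
    by (rule sum.Sigma) (use finE finite_submultisets in auto)
  also have "\<dots> = (\<Sum>(k, h)\<in>Sigma {k. deg d k \<le> n} V. a k / of_real (q ^ deg d k) * of_real (wmu h))"
  proof (rule sum.reindex_bij_witness[where i = "\<lambda>(k, h). (h + k, h)" and j = "\<lambda>(g, h). (g - h, h)"])
    fix t assume "t \<in> Sigma E (\<lambda>g. {h. h \<subseteq># g})"
    then obtain g h where t: "t = (g, h)" "g \<in> E" "h \<subseteq># g" by auto
    then obtain k where k: "g = h + k" by (metis subset_mset.le_iff_add)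
    show "(case case t of (g, h) \<Rightarrow> (g - h, h) of (k, h) \<Rightarrow> (h + k, h)) = t"
      by (simp add: t(1) k)
    show "(case t of (g, h) \<Rightarrow> (g - h, h)) \<in> Sigma {k. deg d k \<le> n} V"
      using t(2) by (simp add: t(1) k V_def E_def)
    show "(case case t of (g, h) \<Rightarrow> (g - h, h) of (k, h) \<Rightarrow> a k / of_real (q ^ deg d k) * of_real (wmu h)) =
        (case t of (g, h) \<Rightarrow> of_int (moebius h) * a (g - h) / of_real (q ^ deg d g))"
      by (simp add: t(1) k wmu_def power_add mult_ac)
  next
    fix t assume "t \<in> Sigma {k. deg d k \<le> n} V"
    then obtain k h where t: "t = (k, h)" "h + k \<in> E" by (auto simp: V_def)
    show "(case case t of (k, h) \<Rightarrow> (h + k, h) of (g, h) \<Rightarrow> (g - h, h)) = t" by (simp add: t(1))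
    show "(case t of (k, h) \<Rightarrow> (h + k, h)) \<in> Sigma E (\<lambda>g. {h. h \<subseteq># g})" using t by simp
  qed
  also have "\<dots> = (\<Sum>k | deg d k \<le> n. \<Sum>h\<in>V k. a k / of_real (q ^ deg d k) * of_real (wmu h))"
    using fin_le finV by (subst sum.Sigma) auto
  also have "\<dots> = (\<Sum>k\<in>insert {#} E. \<Sum>h\<in>V k. a k / of_real (q ^ deg d k) * of_real (wmu h))"
  proof (rule sum.mono_neutral_right[OF fin_le])
    show "\<forall>k\<in>{k. deg d k \<le> n} - insert {#} E. (\<Sum>h\<in>V k. a k / of_real (q ^ deg d k) * of_real (wmu h)) = 0"
    proof
      fix k assume "k \<in> {k. deg d k \<le> n} - insert {#} E"
      hence "k \<notin> DS d S" by (auto simp: E_def Suc_le_eq deg_pos_iff)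
      thus "(\<Sum>h\<in>V k. a k / of_real (q ^ deg d k) * of_real (wmu h)) = 0" by (simp add: supp)
    qed
  qed (auto simp: E_def)
  also have "\<dots> = (\<Sum>h\<in>V {#}. of_real (wmu h)) +
      (\<Sum>k\<in>E. \<Sum>h\<in>V k. a k / of_real (q ^ deg d k) * of_real (wmu h))"
    using finE a0 by (subst sum.insert) (auto simp: E_def)
  also have "V {#} = E" by (auto simp: V_def)
  also have "(\<Sum>k\<in>E. \<Sum>h\<in>V k. a k / of_real (q ^ deg d k) * of_real (wmu h)) =
      (\<Sum>k\<in>E. a k / of_real (q ^ deg d k) * of_real (U S k (n - deg d k)))"
  proof (intro sum.cong refl)
    fix k assume k: "k \<in> E"
    hence "V k = {h. deg d h \<le> n - deg d k \<and> h + k \<in> DS d S}" by (auto simp: V_def E_def)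
    thus "(\<Sum>h\<in>V k. a k / of_real (q ^ deg d k) * of_real (wmu h)) =
        a k / of_real (q ^ deg d k) * of_real (U S k (n - deg d k))"
      by (simp add: U_def sum_distrib_left)
  qed
  also have "\<dots> = (\<Sum>j=1..n. \<Sum>k | k \<in> E \<and> deg d k = j. a k / of_real (q ^ deg d k) * of_real (U S k (n - deg d k)))"
    using finE by (intro sum.group[symmetric]) (auto simp: E_def)
  also have "\<dots> = (\<Sum>j=1..n. \<Sum>k | k \<in> DS d S \<and> deg d k = j. a k / of_real (q ^ j) * of_real (U S k (n - j)))"
    by (intro sum.cong) (auto simp: E_def)
  finally show ?thesis by (simp add: E_def)
qed

lemma summable_norm_coefficients:
  fixes a :: "'p multiset \<Rightarrow> complex"
  assumes conv: "convergent (\<lambda>n. \<Sum>g\<in>{g. 1 \<le> deg d g \<and> deg d g \<le> n \<and> g \<in> DS d S}.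
            norm (a g) / gnorm d q g * ln (ln (gnorm d q g)))"
  shows "summable (\<lambda>j. \<Sum>k | k \<in> DS d S \<and> deg d k = j. norm (a k) / q ^ j)"
proof -
  define \<alpha> where "\<alpha> = (\<lambda>j. \<Sum>k | k \<in> DS d S \<and> deg d k = j. norm (a k) / q ^ j)"
  define L where "L = (\<lambda>j. ln (ln (q ^ j)))"
  have \<alpha>_nonneg: "\<alpha> j \<ge> 0" for j unfolding \<alpha>_def using q_pos by (intro sum_nonneg) auto
  have "(\<Sum>g\<in>{g. 1 \<le> deg d g \<and> deg d g \<le> n \<and> g \<in> DS d S}.
            norm (a g) / gnorm d q g * ln (ln (gnorm d q g))) = (\<Sum>j<n. \<alpha> (Suc j) * L (Suc j))" for n
  proof -
    define E where "E = {g. 1 \<le> deg d g \<and> deg d g \<le> n \<and> g \<in> DS d S}"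
    have finE: "finite E" by (rule finite_subset[OF _ finite_deg_le[of n]]) (auto simp: E_def)
    have "(\<Sum>g\<in>E. norm (a g) / gnorm d q g * ln (ln (gnorm d q g))) =
        (\<Sum>j=1..n. \<Sum>g | g \<in> E \<and> deg d g = j. norm (a g) / gnorm d q g * ln (ln (gnorm d q g)))"
      using finE by (intro sum.group[symmetric]) (auto simp: E_def)
    also have "\<dots> = (\<Sum>j=1..n. \<Sum>g | g \<in> DS d S \<and> deg d g = j. norm (a g) / q ^ j * L j)"
      by (intro sum.cong) (auto simp: E_def gnorm_def L_def)
    also have "\<dots> = (\<Sum>j=1..n. \<alpha> j * L j)" by (simp add: \<alpha>_def sum_distrib_right)
    also have "\<dots> = (\<Sum>j<n. \<alpha> (Suc j) * L (Suc j))"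
      by (rule sum.reindex_bij_witness[of _ Suc "\<lambda>j. j - 1"]) auto
    finally show ?thesis by (simp add: E_def)
  qed
  hence "summable (\<lambda>j. \<alpha> (Suc j) * L (Suc j))"
    using conv by (simp add: summable_iff_convergent)
  hence sum: "summable (\<lambda>j. \<alpha> j * L j)" by (subst (asm) summable_Suc_iff)
  have "filterlim (\<lambda>j. real j * ln q) at_top sequentially"
    using q_gt_1 by (intro filterlim_at_top_mult_tendsto_pos[OF tendsto_const]
        filterlim_real_sequentially) auto
  hence "filterlim (\<lambda>j. ln (real j * ln q)) at_top sequentially"
    by (rule filterlim_compose[OF ln_at_top])
  hence "\<forall>\<^sub>F j in sequentially. ln (real j * ln q) \<ge> 1"
    by (simp add: filterlim_at_top)
  hence "\<forall>\<^sub>F j in sequentially. norm (\<alpha> j) \<le> \<alpha> j * L j"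
  proof eventually_elim
    case (elim j)
    hence "L j \<ge> 1" using q_pos by (simp add: L_def ln_realpow)
    thus ?case using mult_left_mono[of 1 "L j" "\<alpha> j"] \<alpha>_nonneg[of j] by simp
  qed
  hence "summable \<alpha>" using sum by (rule summable_comparison_test_ev)
  thus ?thesis by (simp add: \<alpha>_def)
qed

lemma sum_mconv_tendsto:
  assumes dens: "nat_density d S \<delta>"
    and supp: "\<And>g. g \<notin> DS d S \<Longrightarrow> a g = 0" and a0: "a {#} = 1"
    and conv: "convergent (\<lambda>n. \<Sum>g\<in>{g. 1 \<le> deg d g \<and> deg d g \<le> n \<and> g \<in> DS d S}.
            norm (a g) / gnorm d q g * ln (ln (gnorm d q g)))"
  shows "(\<lambda>n. - (\<Sum>g\<in>{g. 1 \<le> deg d g \<and> deg d g \<le> n \<and> g \<in> DS d S}.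
            mconv a g / of_real (gnorm d q g))) \<longlonglongrightarrow> of_real \<delta>"
proof -
  obtain B where B: "B > 0" "\<And>k x. k \<in> DS d S \<Longrightarrow> k \<noteq> {#} \<Longrightarrow> \<bar>U S k x\<bar> \<le> B"
    using U_bounded[of S] by blast
  \<comment> \<open>The condition \<open>k \<noteq> {#}\<close> changes nothing for
    \<open>j \<ge> 1\<close>, but it makes the summand at \<open>j = 0\<close> empty, so that the
    termwise limit is 0 for every \<open>j\<close>.\<close>
  have "(\<lambda>n. \<Sum>j=1..n. \<Sum>k | k \<in> DS d S \<and> deg d k = j \<and> k \<noteq> {#}.
        a k / of_real (q ^ j) * of_real (U S k (n - j))) \<longlonglongrightarrow> 0"
  proof (rule sum_tendsto_0_dominated)
    show "(\<lambda>n. \<Sum>k | k \<in> DS d S \<and> deg d k = j \<and> k \<noteq> {#}.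
        a k / of_real (q ^ j) * of_real (U S k (n - j))) \<longlonglongrightarrow> 0" for j
    proof (intro tendsto_null_sum tendsto_mult_right_zero)
      fix k assume "k \<in> {k. k \<in> DS d S \<and> deg d k = j \<and> k \<noteq> {#}}"
      hence "U S k \<longlonglongrightarrow> 0" by (intro U_tendsto_0) auto
      from filterlim_compose[OF this filterlim_minus_const_nat_at_top[of j]]
      show "(\<lambda>n. complex_of_real (U S k (n - j))) \<longlonglongrightarrow> 0"
        by (rule tendsto_of_real[of _ 0, simplified])
    qed
    show "norm (\<Sum>k | k \<in> DS d S \<and> deg d k = j \<and> k \<noteq> {#}.
        a k / of_real (q ^ j) * of_real (U S k (n - j))) \<le>
        (\<Sum>k | k \<in> DS d S \<and> deg d k = j. norm (a k) / q ^ j) * B"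
      if "1 \<le> j" "j \<le> n" for j n
    proof -
      have "{k. k \<in> DS d S \<and> deg d k = j \<and> k \<noteq> {#}} = {k. k \<in> DS d S \<and> deg d k = j}"
        using that by auto
      moreover have "norm (\<Sum>k | k \<in> DS d S \<and> deg d k = j \<and> k \<noteq> {#}.
          a k / of_real (q ^ j) * of_real (U S k (n - j))) \<le>
          (\<Sum>k | k \<in> DS d S \<and> deg d k = j \<and> k \<noteq> {#}. norm (a k) / q ^ j * B)"
      proof (rule sum_norm_le)
        fix k assume "k \<in> {k. k \<in> DS d S \<and> deg d k = j \<and> k \<noteq> {#}}"
        thus "norm (a k / of_real (q ^ j) * of_real (U S k (n - j))) \<le> norm (a k) / q ^ j * B"
          unfolding norm_mult norm_divide norm_of_real using B(2)[of k "n - j"] q_pos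
          by (simp add: mult_left_mono divide_right_mono)
      qed
      ultimately show ?thesis by (simp add: sum_distrib_right)
    qed
    show "summable (\<lambda>j. (\<Sum>k | k \<in> DS d S \<and> deg d k = j. norm (a k) / q ^ j) * B)"
      by (intro summable_mult2 summable_norm_coefficients conv)
  qed
  moreover have "(\<Sum>j=1..n. \<Sum>k | k \<in> DS d S \<and> deg d k = j \<and> k \<noteq> {#}.
        a k / of_real (q ^ j) * of_real (U S k (n - j))) =
      (\<Sum>j=1..n. \<Sum>k | k \<in> DS d S \<and> deg d k = j.
        a k / of_real (q ^ j) * of_real (U S k (n - j)))" for n
    by (intro sum.cong) auto
  ultimately have "(\<lambda>n. of_real (- (\<Sum>g | 1 \<le> deg d g \<and> deg d g \<le> n \<and> g \<in> DS d S. wmu g)) -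
     (\<Sum>j=1..n. \<Sum>k | k \<in> DS d S \<and> deg d k = j.
        a k / of_real (q ^ j) * of_real (U S k (n - j)))) \<longlonglongrightarrow> of_real \<delta> - 0"
    by (intro tendsto_diff tendsto_of_real sum_DS_tendsto[OF dens]) simp
  moreover have "- (\<Sum>g\<in>{g. 1 \<le> deg d g \<and> deg d g \<le> n \<and> g \<in> DS d S}. mconv a g / of_real (gnorm d q g)) =
      of_real (- (\<Sum>g | 1 \<le> deg d g \<and> deg d g \<le> n \<and> g \<in> DS d S. wmu g)) -
     (\<Sum>j=1..n. \<Sum>k | k \<in> DS d S \<and> deg d k = j. a k / of_real (q ^ j) * of_real (U S k (n - j)))" for n
    by (subst sum_mconv[where a = a and S = S]) (use supp a0 in auto)
  ultimately show ?thesis by simp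
qed

end

section \<open>The prime element theorem and the conclusion\<close>

text \<open>By the identity theorem on the connected punctured disc, (1 - q z) F(z) = K(q z). At z =
  -1/q the first factor is 2, so F(-1/q) \<noteq> 0 carries over to K(-1).\<close>

lemma Kf_nonzero_at_minus_1:
  assumes z: "zeta_series g l c C \<beta>" and g: "\<And>n. g n = real (Gsharp d n) / q ^ n"
    and \<beta>_eq: "\<beta> = q powr (\<eta> - 1)" and q: "q > 1" and \<eta>: "\<eta> < 1"
    and nz: "zeta_nonzero_at_minus d q \<eta>"
  shows "eval_fps (zeta_series.Kf g) (-1) \<noteq> 0"
proof -
  interpret zeta_series g l c C \<beta> by fact
  obtain F where F: "F holomorphic_on (ball 0 (q powr (-\<eta>)) - {complex_of_real (1/q)})"
    "\<And>z. norm z < 1/q \<Longrightarrow> (\<lambda>n. of_nat (Gsharp d n) * z ^ n) sums F z"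
    "F (complex_of_real (-1/q)) \<noteq> 0"
    using nz unfolding zeta_nonzero_at_minus_def by blast
  define D where "D = ball 0 (q powr (-\<eta>)) - {complex_of_real (1/q)}"
  have lt: "1 / q < q powr (-\<eta>)"
  proof -
    have "q powr (-1) < q powr (-\<eta>)" using q \<eta> by (intro powr_less_mono) auto
    thus ?thesis using q by (simp add: powr_minus_divide)
  qed
  \<comment> \<open>Scaling by \<open>q\<close> therefore maps the disc of continuation into the
    disc of convergence of \<open>Kf\<close>.\<close>
  have radius: "q powr (-\<eta>) * q = 1 / \<beta>"
  proof -
    have "q powr (-\<eta>) * q powr 1 = q powr (-(\<eta> - 1))" by (subst powr_add[symmetric]) simp
    moreover have "q powr 1 = q" using q by simp
    ultimately show ?thesis by (simp only: \<beta>_eq powr_minus_divide)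
  qed
  have key: "(1 - of_real q * z) * F z = eval_fps Kf (of_real q * z)" if "z \<in> D" for z
  proof (rule analytic_continuation_open[where f = "\<lambda>z. (1 - of_real q * z) * F z" and
        g = "\<lambda>z. eval_fps Kf (of_real q * z)" and s = "ball 0 (1/q)" and s' = D])
    show "open D" "connected D"
      unfolding D_def by (auto intro!: open_delete connected_open_delete)
    have "norm (complex_of_real (1/q)) = 1 / q" using q by (simp only: norm_of_real) simp
    thus "ball 0 (1 / q) \<subseteq> D" using lt unfolding D_def by (auto simp del: of_real_divide)
    show "(\<lambda>z. (1 - of_real q * z) * F z) holomorphic_on D"
      using F(1) unfolding D_def by (intro holomorphic_intros)
    have sub: "(\<lambda>z. of_real q * z) ` D \<subseteq> eball 0 (fps_conv_radius Kf)"
    proof clarify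
      fix z assume "z \<in> D"
      hence "norm z < q powr (-\<eta>)" by (simp add: D_def)
      hence "norm (of_real q * z) < 1 / \<beta>"
        using q by (simp add: norm_mult mult.commute[of q] flip: radius)
      hence "ereal (norm (of_real q * z)) < fps_conv_radius Kf"
        using Kf_radius by (meson less_ereal.simps(1) less_le_trans)
      thus "of_real q * z \<in> eball 0 (fps_conv_radius Kf)" by simp
    qed
    have "(eval_fps Kf \<circ> (\<lambda>z. of_real q * z)) holomorphic_on D"
      by (intro holomorphic_on_compose holomorphic_intros sub)
    thus "(\<lambda>z. eval_fps Kf (of_real q * z)) holomorphic_on D" by (simp add: o_def)
    show "(1 - of_real q * z) * F z = eval_fps Kf (of_real q * z)" if "z \<in> ball 0 (1/q)" for z
    proof -
      have n: "norm z < 1 / q" "norm (of_real q * z) < 1"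
        using that q by (auto simp: norm_mult field_simps)
      have "(\<lambda>n. fps_nth Zf n * (of_real q * z) ^ n) sums eval_fps Zf (of_real q * z)"
        using n(2) Zf_radius by (intro sums_eval_fps) (meson less_ereal.simps(1) less_le_trans)
      hence "(\<lambda>n. of_nat (Gsharp d n) * z ^ n) sums eval_fps Zf (of_real q * z)"
        using q by (simp add: Zf_def g power_mult_distrib)
      hence "F z = eval_fps Zf (of_real q * z)" using F(2)[OF n(1)] sums_unique2 by blast
      thus ?thesis by (simp add: Kf_eq[OF n(2)])
    qed
  qed (use q that in auto)
  have "(1 - of_real q * of_real (-1/q)) * F (of_real (-1/q)) = eval_fps Kf (of_real q * of_real (-1/q))"
  proof -
    have "norm (complex_of_real (-1/q)) = 1 / q" using q by (simp only: norm_of_real) simp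
    moreover have "complex_of_real (-1/q) \<noteq> of_real (1/q)"
      using q by (simp only: of_real_eq_iff) simp
    ultimately show ?thesis using lt by (intro key) (simp only: D_def Diff_iff mem_ball_0 singleton_iff simp_thms)
  qed
  moreover have "complex_of_real q * of_real (-1/q) = -1" using q by simp
  ultimately show ?thesis using F(3) by (metis (no_types, lifting) diff_minus_eq_add mult_eq_0_iff one_add_one zero_neq_numeral)
qed

lemma pnt_semigroupI:
  fixes d :: "'p \<Rightarrow> nat"
  assumes "arith_semigroup d" and A: "axiom_A_sharp d c q \<eta>" and nz: "zeta_nonzero_at_minus d q \<eta>"
  shows "pnt_semigroup d q"
proof -
  have q: "c > 0" "q > 1" "0 \<le> \<eta>" "\<eta> < 1" using A by (auto simp: axiom_A_sharp_def)
  obtain C where C: "\<And>n. \<bar>real (Gsharp d n) - c * q ^ n\<bar> \<le> C * q powr (\<eta> * real n)"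
    using A by (auto simp: axiom_A_sharp_def)
  interpret degree_semigroup d q
    using assms(1) q by unfold_locales (auto simp: arith_semigroup_def)
  define g where "g = (\<lambda>n. real (Gsharp d n) / q ^ n)"
  define l where "l = (\<lambda>n. wt 0 n / q ^ n)"
  define \<beta> where "\<beta> = q powr (\<eta> - 1)"
  have zs: "zeta_series g l c C \<beta>"
  proof
    have "{h. deg d h = 0} = {{#}}" by auto
    thus "g 0 = 1" by (simp add: g_def Gsharp_def)
    show "0 < \<beta>" using q by (simp add: \<beta>_def)
    have "q powr (\<eta> - 1) < q powr 0" using q by (intro powr_less_mono) auto
    thus "\<beta> < 1" using q by (simp add: \<beta>_def)
    fix n
    show "g n \<ge> 0" "l n \<ge> 0" using q wt_nonneg by (simp_all add: g_def l_def)
    have "real n * g n = (\<Sum>k=1..n. wt 0 k * real (Gsharp d (n - k)) / q ^ n)"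
      unfolding g_def sum_divide_distrib[symmetric] Gsharp_recursion[symmetric] by simp
    also have "\<dots> = (\<Sum>k=1..n. l k * g (n - k))"
    proof (intro sum.cong refl)
      fix k assume "k \<in> {1..n}"
      hence "q ^ n = q ^ k * q ^ (n - k)" by (simp flip: power_add)
      thus "wt 0 k * real (Gsharp d (n - k)) / q ^ n = l k * g (n - k)" by (simp add: l_def g_def)
    qed
    finally show "real n * g n = (\<Sum>k=1..n. l k * g (n - k))" .
    have "\<bar>g n - c\<bar> = \<bar>real (Gsharp d n) - c * q ^ n\<bar> / q ^ n"
    proof -
      have "g n - c = (real (Gsharp d n) - c * q ^ n) / q ^ n" using q by (simp add: g_def field_simps)
      thus ?thesis using q by (simp add: abs_divide)
    qed
    also have "\<dots> \<le> C * q powr (\<eta> * real n) / q ^ n" using q by (intro divide_right_mono C) auto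
    also have "\<dots> = C * \<beta> ^ n"
    proof -
      have "q powr (\<eta> * real n) / q ^ n = q powr (\<eta> * real n - real n)"
        using q by (simp add: powr_diff powr_realpow)
      also have "\<dots> = \<beta> ^ n"
        using q by (simp add: \<beta>_def powr_powr algebra_simps flip: powr_realpow)
      finally show ?thesis by (simp only: times_divide_eq_right[symmetric])
    qed
    finally show "\<bar>g n - c\<bar> \<le> C * \<beta> ^ n" .
  qed (use q in auto)
  have "eval_fps (zeta_series.Kf g) (-1) \<noteq> 0"
    by (rule Kf_nonzero_at_minus_1[OF zs _ \<beta>_def q(2,4) nz]) (simp add: g_def)
  from zeta_series.abs_summable_log_coeffs[OF zs this]
  show ?thesis by unfold_locales (simp add: l_def)
qed

theorem theorem1p3:
  fixes d :: "'p \<Rightarrow> nat" and c q \<eta> \<delta> :: real and S :: "'p set"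
    and a :: "'p multiset \<Rightarrow> complex"
  assumes "arith_semigroup d"
    and "axiom_A_sharp d c q \<eta>"
    and "zeta_nonzero_at_minus d q \<eta>"
    and "nat_density d S \<delta>"
    and "\<forall>g. g \<notin> DS d S \<longrightarrow> a g = 0"
    and "a {#} = 1"
    and "convergent (\<lambda>n. \<Sum>g\<in>{g. 1 \<le> deg d g \<and> deg d g \<le> n \<and> g \<in> DS d S}.
            norm (a g) / gnorm d q g * ln (ln (gnorm d q g)))"
  shows "((\<lambda>n. - (\<Sum>g\<in>{g. 1 \<le> deg d g \<and> deg d g \<le> n \<and> g \<in> DS d S}.
            mconv a g / of_real (gnorm d q g))) \<longlonglongrightarrow> of_real \<delta>)
       \<and> ((\<lambda>n. - (\<Sum>g\<in>{g. 1 \<le> deg d g \<and> deg d g \<le> n \<and> g \<in> DS d S}.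
            of_int (moebius g) / of_real (gnorm d q g))) \<longlonglongrightarrow> (of_real \<delta> :: complex))"
proof -
  interpret pnt_semigroup d q using assms(1-3) by (rule pnt_semigroupI)
  \<comment> \<open>The second limit is the pure Moebius sum, read as a complex number.\<close>
  have "(\<lambda>n. complex_of_real (- (\<Sum>g | 1 \<le> deg d g \<and> deg d g \<le> n \<and> g \<in> DS d S. wmu g))) \<longlonglongrightarrow> of_real \<delta>"
    by (intro tendsto_of_real sum_DS_tendsto assms(4))
  thus ?thesis
    using sum_mconv_tendsto[OF assms(4) _ assms(6,7)] assms(5) by (simp add: wmu_def gnorm_def)
qed

end
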